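(* Let $(H,K,\rightharpoonup,\leftharpoonup)$ be a matched pair of Hopf algebras whose double cross product $K\bowtie H$ has a projection $\theta$ onto $H$, i.e. $\theta:K\bowtie H\to H$ is a Hopf algebra homomorphism with $\theta\iota_H=\mathrm{id}_H$. Then the map $\pi=\theta\iota_K:K\to H$ is a relative Rota-Baxter operator on $H$ with respect to $(K_\pi,\rightharpoonup)$, where $K_\pi=(K,\bullet_\pi,1_K,\Delta_K,\varepsilon_K,S_\pi)$ is the braided Hopf algebra in ${}^H_H\mathcal{YD}$ with $$a\bullet_\pi b=a_1(\pi(S_K(a_2))\rightharpoonup b),\qquad S_\pi(a)=\pi(a_1)\rightharpoonup S_K(a_2),$$ $H$-action $\rightharpoonup$ and $H$-coaction $a\mapsto\pi(a_1S_K(a_3))\otimes a_2$.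
   Context: Everything is over a fixed arbitrary field $\mathbf{k}$; Sweedler notation $\Delta(x)=x_1\otimes x_2$, $\Delta^{(2)}(x)=x_1\otimes x_2\otimes x_3$; $S_H,S_K$ are antipodes. A matched pair of Hopf algebras $(H,K,\rightharpoonup,\leftharpoonup)$ consists of Hopf algebras $H,K$, a left $H$-module coalgebra action $\rightharpoonup:H\otimes K\to K$ on $K$ and a right $K$-module coalgebra action $\leftharpoonup:H\otimes K\to H$ on $H$ (so both maps are module actions and coalgebra maps) such that for all $x,y\in H$, $a,b\in K$: $x\rightharpoonup ab=(x_1\rightharpoonup a_1)((x_2\leftharpoonup a_2)\rightharpoonup b)$; $x\rightharpoonup 1_K=\varepsilon_H(x)1_K$; $xy\leftharpoonup a=(x\leftharpoonup(y_1\rightharpoonup a_1))(y_2\leftharpoonup a_2)$; $1_H\leftharpoonup a=\varepsilon_K(a)1_H$; $(x_1\rightharpoonup a_1)\otimes(x_2\leftharpoonup a_2)=(x_2\rightharpoonup a_2)\otimes(x_1\leftharpoonup a_1)$. The double cross product $K\bowtie H$ is the Hopf algebra on $K\otimes H$ with product $(a\otimes x)(b\otimes y)=a(x_1\rightharpoonup b_1)\otimes(x_2\leftharpoonup b_2)y$, unit $1_K\otimes 1_H$, the tensor product coalgebra structure, and antipode $a\otimes x\mapsto (1\otimes S_H(x))(S_K(a)\otimes 1)$. The inclusions are $\iota_K:K\to K\bowtie H$, $a\mapsto a\otimes 1_H$, and $\iota_H:H\to K\bowtie H$, $x\mapsto 1_K\otimes x$. A (left-left) Yetter-Drinfeld module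 over $H$ is a left $H$-module $(M,\cdot)$ that is also a left $H$-comodule with coaction $\rho(m)=m_{-1}\otimes m_0\in H\otimes M$, such that $\rho(x\cdot m)=x_1m_{-1}S_H(x_3)\otimes(x_2\cdot m_0)$. Morphisms are $H$-linear and $H$-colinear maps. Tensor products carry $x\cdot(m\otimes n)=(x_1\cdot m)\otimes(x_2\cdot n)$ and $\rho(m\otimes n)=m_{-1}n_{-1}\otimes(m_0\otimes n_0)$; the (pre-)braiding is $c_{M,N}(m\otimes n)=(m_{-1}\cdot n)\otimes m_0$. A braided Hopf algebra (Hopf algebra) $L$ in ${}^H_H\mathcal{YD}$ is an object that is a unital algebra and a counital coalgebra whose structure maps (product, unit, coproduct, counit, antipode) are morphisms in ${}^H_H\mathcal{YD}$, with $\varepsilon_L$ an algebra map, $\Delta_L(1)=1\otimes 1$, $\Delta_L(ab)=a_1((a_2)_{-1}\cdot b_1)\otimes(a_2)_0b_2$, and with antipode $S_L$ the convolution inverse of $\mathrm{id}_L$. Relative Rota-Baxter operator: let $H$ be a Hopf algebra, $L$ a Hopf algebra in ${}^H_H\mathcal{YD}$ with respect to an $H$-action $\rightharpoonup$ and the $H$-coaction $\mathrm{Coad}_\pi:L\to H\otimes L$, $a\mapsto\pi(a_1)S_H(\pi(a_3))\otimes a_2$, where $\pi:L\to H$ is a coalgebra homomorphism such that $\pi(a)\pi(b)=\pi(a_1(\pi(a_2)\rightharpoonup b))$ for all $a,b\in L$ (product on the right-hand side inside $\pi$ taken in $L$). Then $\pi$ is called a (Yetter-Drinfeld) relative Rota-Baxter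 operator on $H$ with respect to $(L,\rightharpoonup)$. *)

theory Defs
  imports "HOL.Vector_Spaces" "HOL-Library.Function_Algebras"
begin

section \<open>Vector spaces and tensor products\<close>

text \<open>
  Isabelle types cannot depend on the scalar multiplications of two vector spaces, so the
  tensor product cannot be formed as a type. A vector space over the field \<open>'k\<close> is therefore
  a subspace of an ambient vector space whose underlying set is a type \<open>'a\<close>; the whole type
  is the special case \<open>carrier V = UNIV\<close>. Maps are only specified on carriers.
\<close>

record ('k, 'a) vspace =
  carrier :: "'a set"
  scale :: "'k \<Rightarrow> 'a \<Rightarrow> 'a"

definition is_vspace :: "('k::field, 'a::ab_group_add, 'z) vspace_scheme \<Rightarrow> bool" where
  "is_vspace V \<longleftrightarrow> vector_space (scale V) \<and> module.subspace (scale V) (carrier V)"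

definition ground :: "('k::field, 'k) vspace" where
  "ground = \<lparr>carrier = UNIV, scale = (*)\<rparr>"

definition lin ::
  "('k::field, 'a::ab_group_add, 'y) vspace_scheme \<Rightarrow> ('k, 'b::ab_group_add, 'z) vspace_scheme
    \<Rightarrow> ('a \<Rightarrow> 'b) \<Rightarrow> bool" where
  "lin V W f \<longleftrightarrow>
     (\<forall>v\<in>carrier V. f v \<in> carrier W) \<and>
     (\<forall>v\<in>carrier V. \<forall>v'\<in>carrier V. f (v + v') = f v + f v') \<and>
     (\<forall>c. \<forall>v\<in>carrier V. f (scale V c v) = scale W c (f v))"

definition bilin ::
  "('k::field, 'a::ab_group_add, 'x) vspace_scheme \<Rightarrow> ('k, 'b::ab_group_add, 'y) vspace_scheme
    \<Rightarrow> ('k, 'c::ab_group_add, 'z) vspace_scheme \<Rightarrow> ('a \<Rightarrow> 'b \<Rightarrow> 'c) \<Rightarrow> bool" where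
  "bilin V W U f \<longleftrightarrow>
     (\<forall>v\<in>carrier V. lin W U (f v)) \<and> (\<forall>w\<in>carrier W. lin V U (\<lambda>v. f v w))"

text \<open>
  Over a field the tensor product embeds into the dual of the space of bilinear forms,
  \<open>v \<otimes> w\<close> being evaluation at \<open>(v, w)\<close>; it is realised here as the span of these evaluations.
  Since tensor products of subspaces are subspaces of the tensor product, forms on the ambient
  spaces may be used. The universal property is proved below.
\<close>

type_synonym ('k, 'a, 'b) tensor = "('a \<Rightarrow> 'b \<Rightarrow> 'k) \<Rightarrow> 'k"

definition bilinear_form ::
  "('k::field, 'a::ab_group_add, 'y) vspace_scheme \<Rightarrow> ('k, 'b::ab_group_add, 'z) vspace_scheme
    \<Rightarrow> ('a \<Rightarrow> 'b \<Rightarrow> 'k) \<Rightarrow> bool" where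
  "bilinear_form V W \<beta> \<longleftrightarrow>
     (\<forall>v. Vector_Spaces.linear (scale W) (*) (\<beta> v)) \<and>
     (\<forall>w. Vector_Spaces.linear (scale V) (*) (\<lambda>v. \<beta> v w))"

definition tens ::
  "('k::field, 'a::ab_group_add, 'y) vspace_scheme \<Rightarrow> ('k, 'b::ab_group_add, 'z) vspace_scheme
    \<Rightarrow> 'a \<Rightarrow> 'b \<Rightarrow> ('k, 'a, 'b) tensor" where
  "tens V W v w = (\<lambda>\<beta>. if bilinear_form V W \<beta> then \<beta> v w else 0)"

definition tensor_scale :: "'k::field \<Rightarrow> ('x \<Rightarrow> 'k) \<Rightarrow> ('x \<Rightarrow> 'k)" where
  "tensor_scale c t = (\<lambda>\<beta>. c * t \<beta>)"

definition tensor_space ::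
  "('k::field, 'a::ab_group_add, 'y) vspace_scheme \<Rightarrow> ('k, 'b::ab_group_add, 'z) vspace_scheme
    \<Rightarrow> ('k, ('k, 'a, 'b) tensor) vspace" where
  "tensor_space V W =
     \<lparr>carrier = module.span tensor_scale {tens V W v w | v w. v \<in> carrier V \<and> w \<in> carrier W},
      scale = tensor_scale\<rparr>"

text \<open>
  \<open>tlift V W f\<close> is the linear map on \<open>V \<otimes> W\<close> induced by a bilinear map \<open>f\<close>: the value at
  \<open>t = \<Sum> v\<^sub>i \<otimes> w\<^sub>i\<close> is \<open>\<Sum> f v\<^sub>i w\<^sub>i\<close>, computed from a chosen decomposition of \<open>t\<close>. The result is
  independent of this choice if \<open>f\<close> is bilinear, see the lemmas below.
\<close>

definition decomposition ::
  "('k::field, 'a::ab_group_add, 'y) vspace_scheme \<Rightarrow> ('k, 'b::ab_group_add, 'z) vspace_scheme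
    \<Rightarrow> ('k, 'a, 'b) tensor \<Rightarrow> ('a \<times> 'b) list" where
  "decomposition V W t =
     (SOME l. set l \<subseteq> carrier V \<times> carrier W \<and> t = (\<Sum>(v, w)\<leftarrow>l. tens V W v w))"

definition tlift ::
  "('k::field, 'a::ab_group_add, 'y) vspace_scheme \<Rightarrow> ('k, 'b::ab_group_add, 'z) vspace_scheme
    \<Rightarrow> ('a \<Rightarrow> 'b \<Rightarrow> 'c::ab_group_add) \<Rightarrow> ('k, 'a, 'b) tensor \<Rightarrow> 'c" where
  "tlift V W f t = (\<Sum>(v, w)\<leftarrow>decomposition V W t. f v w)"


subsection \<open>The universal property\<close>

lemma vector_space_mult: "vector_space ((*) :: 'k::field \<Rightarrow> 'k \<Rightarrow> 'k)"
  by standard (auto simp: algebra_simps)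

lemma vector_space_tensor_scale:
  "vector_space (tensor_scale :: 'k::field \<Rightarrow> ('x \<Rightarrow> 'k) \<Rightarrow> ('x \<Rightarrow> 'k))"
  by standard (auto simp: tensor_scale_def fun_eq_iff algebra_simps)

lemma is_vspace_ground: "is_vspace ground"
proof -
  interpret vector_space "(*) :: 'a \<Rightarrow> 'a \<Rightarrow> 'a" by (rule vector_space_mult)
  show ?thesis by (simp add: is_vspace_def ground_def vector_space_mult)
qed

lemma is_vspace_tensor_space:
  fixes V :: "('k::field, 'a::ab_group_add, 'y) vspace_scheme"
    and W :: "('k, 'b::ab_group_add, 'z) vspace_scheme"
  shows "is_vspace (tensor_space V W)"
proof -
  interpret vector_space "tensor_scale :: 'k \<Rightarrow> ('k, 'a, 'b) tensor \<Rightarrow> _"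
    by (rule vector_space_tensor_scale)
  show ?thesis by (simp add: is_vspace_def tensor_space_def vector_space_tensor_scale)
qed

lemma tens_in_tensor_space:
  fixes V :: "('k::field, 'a::ab_group_add, 'y) vspace_scheme"
    and W :: "('k, 'b::ab_group_add, 'z) vspace_scheme"
  assumes "v \<in> carrier V" "w \<in> carrier W"
  shows "tens V W v w \<in> carrier (tensor_space V W)"
proof -
  interpret vector_space "tensor_scale :: 'k \<Rightarrow> ('k, 'a, 'b) tensor \<Rightarrow> _"
    by (rule vector_space_tensor_scale)
  show ?thesis using assms by (auto simp: tensor_space_def intro!: span_base)
qed

lemma bilin_tens:
  assumes "is_vspace V" "is_vspace W"
  shows "bilin V W (tensor_space V W) (tens V W)"
  unfolding bilin_def lin_def
  by (auto simp: tens_in_tensor_space)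
     (auto simp: tens_def fun_eq_iff tensor_space_def tensor_scale_def bilinear_form_def
       linear_iff)

lemma exists_decomposition:
  fixes V :: "('k::field, 'a::ab_group_add, 'y) vspace_scheme"
    and W :: "('k, 'b::ab_group_add, 'z) vspace_scheme"
  assumes V: "is_vspace V" and W: "is_vspace W" and t: "t \<in> carrier (tensor_space V W)"
  shows "\<exists>l. set l \<subseteq> carrier V \<times> carrier W \<and> t = (\<Sum>(v, w)\<leftarrow>l. tens V W v w)"
proof -
  interpret vector_space "tensor_scale :: 'k \<Rightarrow> ('k, 'a, 'b) tensor \<Rightarrow> _"
    by (rule vector_space_tensor_scale)
  interpret V: vector_space "scale V" using V by (simp add: is_vspace_def)
  have sub: "V.subspace (carrier V)" using V by (simp add: is_vspace_def)
  from t have "t \<in> span {tens V W v w | v w. v \<in> carrier V \<and> w \<in> carrier W}"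
    by (simp add: tensor_space_def)
  then show ?thesis
  proof (induction rule: span_induct_alt)
    case base
    show ?case by (rule exI[of _ "[]"]) simp
  next
    case (step c x y)
    then obtain l v w where l: "set l \<subseteq> carrier V \<times> carrier W"
      "y = (\<Sum>(v, w)\<leftarrow>l. tens V W v w)" "v \<in> carrier V" "w \<in> carrier W" "x = tens V W v w"
      by blast
    have "tensor_scale c x = tens V W (scale V c v) w"
      using bilin_tens[OF V W] l(3-5) unfolding bilin_def lin_def by (simp add: tensor_space_def)
    then show ?case using l V.subspace_scale[OF sub l(3)]
      by (intro exI[of _ "(scale V c v, w) # l"]) auto
  qed
qed

lemma linear_functionals_separate:
  assumes "vector_space s" and "\<And>\<phi>. Vector_Spaces.linear s (*) \<phi> \<Longrightarrow> \<phi> u = \<phi> u'"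
  shows "u = u'"
proof (rule ccontr)
  assume ne: "u \<noteq> u'"
  interpret vector_space_pair s "(*)"
    using assms(1) vector_space_mult by (rule vector_space_pair.intro)
  have "vs1.independent {u - u'}" using ne by simp
  from linear_independent_extend[OF this, of "\<lambda>_. 1"]
  obtain \<phi> where \<phi>: "Vector_Spaces.linear s (*) \<phi>" "\<phi> (u - u') = 1" by auto
  then interpret \<phi>: Vector_Spaces.linear s "(*)" \<phi> by simp
  from assms(2)[OF \<phi>(1)] \<phi>(2) show False by (simp add: \<phi>.diff)
qed

lemma subspace_projection:
  assumes "is_vspace V"
  obtains p where "Vector_Spaces.linear (scale V) (scale V) p"
    "\<And>v. p v \<in> carrier V" "\<And>v. v \<in> carrier V \<Longrightarrow> p v = v"
proof -
  have vs: "vector_space (scale V)" and sub: "module.subspace (scale V) (carrier V)"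
    using assms by (simp_all add: is_vspace_def)
  interpret vector_space_pair "scale V" "scale V"
    using vs vs by (rule vector_space_pair.intro)
  from linear_exists_left_inverse_on[OF vs1.linear_id sub] that show ?thesis
    by (auto simp: id_def)
qed

lemma sum_decomposition_unique:
  assumes V: "is_vspace V" and W: "is_vspace W" and U: "is_vspace U" and f: "bilin V W U f"
    and l: "set l \<subseteq> carrier V \<times> carrier W" and l': "set l' \<subseteq> carrier V \<times> carrier W"
    and eq: "(\<Sum>(v, w)\<leftarrow>l. tens V W v w) = (\<Sum>(v, w)\<leftarrow>l'. tens V W v w)"
  shows "(\<Sum>(v, w)\<leftarrow>l. f v w) = (\<Sum>(v, w)\<leftarrow>l'. f v w)"
proof -
  have vsU: "vector_space (scale U)" using U by (simp add: is_vspace_def)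
  obtain p where p: "Vector_Spaces.linear (scale V) (scale V) p"
    "\<And>v. p v \<in> carrier V" "\<And>v. v \<in> carrier V \<Longrightarrow> p v = v"
    using subspace_projection[OF V] by blast
  obtain q where q: "Vector_Spaces.linear (scale W) (scale W) q"
    "\<And>v. q v \<in> carrier W" "\<And>v. v \<in> carrier W \<Longrightarrow> q v = v"
    using subspace_projection[OF W] by blast
  show ?thesis
  proof (rule linear_functionals_separate[OF vsU])
    fix \<phi> assume \<phi>: "Vector_Spaces.linear (scale U) (*) \<phi>"
    then interpret \<phi>: Vector_Spaces.linear "scale U" "(*)" \<phi> .
    define \<beta> where "\<beta> v w = \<phi> (f (p v) (q w))" for v w
    have form: "bilinear_form V W \<beta>"
      using f p q V W \<phi>
      unfolding bilinear_form_def linear_iff bilin_def lin_def \<beta>_def is_vspace_def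
      by auto
    have ev: "(\<Sum>(v, w)\<leftarrow>l. tens V W v w) \<beta> = \<phi> (\<Sum>(v, w)\<leftarrow>l. f v w)"
      if "set l \<subseteq> carrier V \<times> carrier W" for l
      using that
      by (induction l) (auto simp: tens_def form \<beta>_def p q \<phi>.zero \<phi>.add)
    show "\<phi> (\<Sum>(v, w)\<leftarrow>l. f v w) = \<phi> (\<Sum>(v, w)\<leftarrow>l'. f v w)"
      using ev[OF l] ev[OF l'] eq by simp
  qed
qed

lemma tlift_eq_sum:
  assumes V: "is_vspace V" and W: "is_vspace W" and U: "is_vspace U" and f: "bilin V W U f"
    and l: "set l \<subseteq> carrier V \<times> carrier W" "t = (\<Sum>(v, w)\<leftarrow>l. tens V W v w)"
  shows "tlift V W f t = (\<Sum>(v, w)\<leftarrow>l. f v w)"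
proof -
  let ?P = "\<lambda>l. set l \<subseteq> carrier V \<times> carrier W \<and> t = (\<Sum>(v, w)\<leftarrow>l. tens V W v w)"
  have "?P (decomposition V W t)"
    unfolding decomposition_def by (rule someI[of ?P l]) (use l in simp)
  then show ?thesis
    unfolding tlift_def by (intro sum_decomposition_unique[OF V W U f _ l(1)]) (use l in auto)
qed

lemma tlift_tens:
  assumes "is_vspace V" "is_vspace W" "is_vspace U" "bilin V W U f"
    and "v \<in> carrier V" "w \<in> carrier W"
  shows "tlift V W f (tens V W v w) = f v w"
  using tlift_eq_sum[OF assms(1-4), of "[(v, w)]"] assms(5,6) by simp

lemma lin_tlift:
  assumes V: "is_vspace V" and W: "is_vspace W" and U: "is_vspace U" and f: "bilin V W U f"
  shows "lin (tensor_space V W) U (tlift V W f)"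
proof -
  interpret V: vector_space "scale V" using V by (simp add: is_vspace_def)
  interpret U: vector_space "scale U" using U by (simp add: is_vspace_def)
  have subV: "V.subspace (carrier V)" and subU: "U.subspace (carrier U)"
    using V U by (simp_all add: is_vspace_def)
  note ex = exists_decomposition[OF V W]
  note ev = tlift_eq_sum[OF V W U f]
  show ?thesis unfolding lin_def
  proof (intro conjI ballI allI)
    fix t assume "t \<in> carrier (tensor_space V W)"
    from ex[OF this] obtain l where l: "set l \<subseteq> carrier V \<times> carrier W"
      "t = (\<Sum>(v, w)\<leftarrow>l. tens V W v w)" by blast
    have "(\<Sum>(v, w)\<leftarrow>l. f v w) \<in> carrier U"
      using l(1) f subU
      by (induction l) (auto simp: U.subspace_0 bilin_def lin_def intro!: U.subspace_add)
    then show "tlift V W f t \<in> carrier U" using ev[OF l] by simp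
    fix c
    let ?m = "map (\<lambda>(v, w). (scale V c v, w)) l"
    have m: "set ?m \<subseteq> carrier V \<times> carrier W"
      using l(1) V.subspace_scale[OF subV] by auto
    have tens: "tens V W (scale V c v) w = tensor_scale c (tens V W v w)"
      if "v \<in> carrier V" "w \<in> carrier W" for v w
      using bilin_tens[OF V W] that unfolding bilin_def lin_def by (simp add: tensor_space_def)
    have "tensor_scale c t = (\<Sum>(v, w)\<leftarrow>?m. tens V W v w)"
      unfolding l(2) using l(1)
      by (induction l) (auto simp: tens tensor_scale_def fun_eq_iff algebra_simps)
    from ev[OF m this] have "tlift V W f (tensor_scale c t) = (\<Sum>(v, w)\<leftarrow>?m. f v w)" .
    also have "\<dots> = scale U c (\<Sum>(v, w)\<leftarrow>l. f v w)"
      using l(1) f by (induction l) (auto simp: bilin_def lin_def U.scale_right_distrib)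
    finally show "tlift V W f (scale (tensor_space V W) c t) = scale U c (tlift V W f t)"
      using ev[OF l] by (simp add: tensor_space_def)
  next
    fix t t' assume "t \<in> carrier (tensor_space V W)" "t' \<in> carrier (tensor_space V W)"
    then obtain l l' where l: "set l \<subseteq> carrier V \<times> carrier W"
      "t = (\<Sum>(v, w)\<leftarrow>l. tens V W v w)" and l': "set l' \<subseteq> carrier V \<times> carrier W"
      "t' = (\<Sum>(v, w)\<leftarrow>l'. tens V W v w)" using ex by meson
    show "tlift V W f (t + t') = tlift V W f t + tlift V W f t'"
      using ev[OF l] ev[OF l'] ev[of "l @ l'" "t + t'"] l l' by simp
  qed
qed


section \<open>Hopf algebras\<close>

text \<open>Bilinear maps are curried; the linear map on the tensor product is \<open>tlift\<close> of them.\<close>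

record ('k, 'a) hopf = "('k, 'a) vspace" +
  mult :: "'a \<Rightarrow> 'a \<Rightarrow> 'a"
  one :: 'a
  comult :: "'a \<Rightarrow> ('k, 'a, 'a) tensor"
  counit :: "'a \<Rightarrow> 'k"
  antipode :: "'a \<Rightarrow> 'a"

text \<open>
  Sweedler notation: \<open>sweedler C x f\<close> is \<open>f x\<^sub>1 x\<^sub>2\<close> and \<open>sweedler3 C x f\<close> is \<open>f x\<^sub>1 x\<^sub>2 x\<^sub>3\<close>,
  for \<open>f\<close> bilinear and trilinear, respectively.
\<close>

definition sweedler ::
  "('k::field, 'a::ab_group_add, 'z) hopf_scheme \<Rightarrow> 'a \<Rightarrow> ('a \<Rightarrow> 'a \<Rightarrow> 'b::ab_group_add) \<Rightarrow> 'b" where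
  "sweedler C x f = tlift C C f (comult C x)"

definition sweedler3 ::
  "('k::field, 'a::ab_group_add, 'z) hopf_scheme \<Rightarrow> 'a \<Rightarrow> ('a \<Rightarrow> 'a \<Rightarrow> 'a \<Rightarrow> 'b::ab_group_add) \<Rightarrow> 'b"
  where
  "sweedler3 C x f = sweedler C x (\<lambda>x1 y. sweedler C y (\<lambda>x2 x3. f x1 x2 x3))"

definition algebra :: "('k::field, 'a::ab_group_add, 'z) hopf_scheme \<Rightarrow> bool" where
  "algebra A \<longleftrightarrow>
     is_vspace A \<and> bilin A A A (mult A) \<and> one A \<in> carrier A \<and>
     (\<forall>x\<in>carrier A. \<forall>y\<in>carrier A. \<forall>z\<in>carrier A.
        mult A (mult A x y) z = mult A x (mult A y z)) \<and>
     (\<forall>x\<in>carrier A. mult A (one A) x = x \<and> mult A x (one A) = x)"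

definition coalgebra :: "('k::field, 'a::ab_group_add, 'z) hopf_scheme \<Rightarrow> bool" where
  "coalgebra C \<longleftrightarrow>
     is_vspace C \<and> lin C (tensor_space C C) (comult C) \<and> lin C ground (counit C) \<and>
     (\<forall>x\<in>carrier C.
        sweedler C x (\<lambda>x1 x2. sweedler C x1 (\<lambda>x11 x12.
          tens C (tensor_space C C) x11 (tens C C x12 x2))) =
        sweedler C x (\<lambda>x1 x2. tens C (tensor_space C C) x1 (comult C x2))) \<and>
     (\<forall>x\<in>carrier C. sweedler C x (\<lambda>x1 x2. scale C (counit C x1) x2) = x) \<and>
     (\<forall>x\<in>carrier C. sweedler C x (\<lambda>x1 x2. scale C (counit C x2) x1) = x)"

definition convolution_inverse_id :: "('k::field, 'a::ab_group_add, 'z) hopf_scheme \<Rightarrow> bool" where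
  "convolution_inverse_id A \<longleftrightarrow>
     lin A A (antipode A) \<and>
     (\<forall>x\<in>carrier A.
        sweedler A x (\<lambda>x1 x2. mult A (antipode A x1) x2) = scale A (counit A x) (one A) \<and>
        sweedler A x (\<lambda>x1 x2. mult A x1 (antipode A x2)) = scale A (counit A x) (one A))"

definition counit_algebra_map :: "('k::field, 'a::ab_group_add, 'z) hopf_scheme \<Rightarrow> bool" where
  "counit_algebra_map A \<longleftrightarrow>
     counit A (one A) = 1 \<and>
     (\<forall>x\<in>carrier A. \<forall>y\<in>carrier A. counit A (mult A x y) = counit A x * counit A y)"

definition hopf_algebra :: "('k::field, 'a::ab_group_add, 'z) hopf_scheme \<Rightarrow> bool" where
  "hopf_algebra A \<longleftrightarrow>
     algebra A \<and> coalgebra A \<and> counit_algebra_map A \<and>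
     comult A (one A) = tens A A (one A) (one A) \<and>
     (\<forall>x\<in>carrier A. \<forall>y\<in>carrier A.
        comult A (mult A x y) =
        sweedler A x (\<lambda>x1 x2. sweedler A y (\<lambda>y1 y2. tens A A (mult A x1 y1) (mult A x2 y2)))) \<and>
     convolution_inverse_id A"

definition coalgebra_hom ::
  "('k::field, 'a::ab_group_add, 'y) hopf_scheme \<Rightarrow> ('k, 'b::ab_group_add, 'z) hopf_scheme
    \<Rightarrow> ('a \<Rightarrow> 'b) \<Rightarrow> bool" where
  "coalgebra_hom C D f \<longleftrightarrow>
     lin C D f \<and>
     (\<forall>x\<in>carrier C. comult D (f x) = sweedler C x (\<lambda>x1 x2. tens D D (f x1) (f x2))) \<and>
     (\<forall>x\<in>carrier C. counit D (f x) = counit C x)"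

text \<open>Compatibility with the antipodes is automatic for bialgebra maps between Hopf algebras.\<close>

definition hopf_hom ::
  "('k::field, 'a::ab_group_add, 'y) hopf_scheme \<Rightarrow> ('k, 'b::ab_group_add, 'z) hopf_scheme
    \<Rightarrow> ('a \<Rightarrow> 'b) \<Rightarrow> bool" where
  "hopf_hom A B f \<longleftrightarrow>
     coalgebra_hom A B f \<and> f (one A) = one B \<and>
     (\<forall>x\<in>carrier A. \<forall>y\<in>carrier A. f (mult A x y) = mult B (f x) (f y))"


section \<open>Matched pairs and double cross products\<close>

definition left_module ::
  "('k::field, 'h::ab_group_add, 'y) hopf_scheme \<Rightarrow> ('k, 'm::ab_group_add, 'z) vspace_scheme
    \<Rightarrow> ('h \<Rightarrow> 'm \<Rightarrow> 'm) \<Rightarrow> bool" where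
  "left_module H M act \<longleftrightarrow>
     is_vspace M \<and> bilin H M M act \<and>
     (\<forall>x\<in>carrier H. \<forall>y\<in>carrier H. \<forall>m\<in>carrier M. act (mult H x y) m = act x (act y m)) \<and>
     (\<forall>m\<in>carrier M. act (one H) m = m)"

definition right_module ::
  "('k::field, 'm::ab_group_add, 'y) vspace_scheme \<Rightarrow> ('k, 'h::ab_group_add, 'z) hopf_scheme
    \<Rightarrow> ('m \<Rightarrow> 'h \<Rightarrow> 'm) \<Rightarrow> bool" where
  "right_module M H act \<longleftrightarrow>
     is_vspace M \<and> bilin M H M act \<and>
     (\<forall>x\<in>carrier H. \<forall>y\<in>carrier H. \<forall>m\<in>carrier M. act m (mult H x y) = act (act m x) y) \<and>
     (\<forall>m\<in>carrier M. act m (one H) = m)"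

text \<open>
  \<open>bilinear_coalgebra_map C D E f\<close>: the linear map \<open>C \<otimes> D \<rightarrow> E\<close> induced by \<open>f\<close> is a
  coalgebra map, where \<open>C \<otimes> D\<close> carries the tensor product coalgebra structure.
\<close>

definition bilinear_coalgebra_map ::
  "('k::field, 'a::ab_group_add, 'x) hopf_scheme \<Rightarrow> ('k, 'b::ab_group_add, 'y) hopf_scheme
    \<Rightarrow> ('k, 'c::ab_group_add, 'z) hopf_scheme \<Rightarrow> ('a \<Rightarrow> 'b \<Rightarrow> 'c) \<Rightarrow> bool" where
  "bilinear_coalgebra_map C D E f \<longleftrightarrow>
     bilin C D E f \<and>
     (\<forall>x\<in>carrier C. \<forall>a\<in>carrier D.
        comult E (f x a) =
          sweedler C x (\<lambda>x1 x2. sweedler D a (\<lambda>a1 a2. tens E E (f x1 a1) (f x2 a2))) \<and>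
        counit E (f x a) = counit C x * counit D a)"

definition matched_pair ::
  "('k::field, 'h::ab_group_add, 'y) hopf_scheme \<Rightarrow> ('k, 'l::ab_group_add, 'z) hopf_scheme
    \<Rightarrow> ('h \<Rightarrow> 'l \<Rightarrow> 'l) \<Rightarrow> ('h \<Rightarrow> 'l \<Rightarrow> 'h) \<Rightarrow> bool" where
  "matched_pair H K la ra \<longleftrightarrow>
     hopf_algebra H \<and> hopf_algebra K \<and>
     left_module H K la \<and> bilinear_coalgebra_map H K K la \<and>
     right_module H K ra \<and> bilinear_coalgebra_map H K H ra \<and>
     (\<forall>x\<in>carrier H. \<forall>a\<in>carrier K. \<forall>b\<in>carrier K.
        la x (mult K a b) =
        sweedler H x (\<lambda>x1 x2. sweedler K a (\<lambda>a1 a2. mult K (la x1 a1) (la (ra x2 a2) b)))) \<and>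
     (\<forall>x\<in>carrier H. la x (one K) = scale K (counit H x) (one K)) \<and>
     (\<forall>x\<in>carrier H. \<forall>y\<in>carrier H. \<forall>a\<in>carrier K.
        ra (mult H x y) a =
        sweedler H y (\<lambda>y1 y2. sweedler K a (\<lambda>a1 a2. mult H (ra x (la y1 a1)) (ra y2 a2)))) \<and>
     (\<forall>a\<in>carrier K. ra (one H) a = scale H (counit K a) (one H)) \<and>
     (\<forall>x\<in>carrier H. \<forall>a\<in>carrier K.
        sweedler H x (\<lambda>x1 x2. sweedler K a (\<lambda>a1 a2. tens K H (la x1 a1) (ra x2 a2))) =
        sweedler H x (\<lambda>x1 x2. sweedler K a (\<lambda>a1 a2. tens K H (la x2 a2) (ra x1 a1))))"

definition dcp_mult ::
  "('k::field, 'h::ab_group_add, 'y) hopf_scheme \<Rightarrow> ('k, 'l::ab_group_add, 'z) hopf_scheme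
    \<Rightarrow> ('h \<Rightarrow> 'l \<Rightarrow> 'l) \<Rightarrow> ('h \<Rightarrow> 'l \<Rightarrow> 'h)
    \<Rightarrow> ('k, 'l, 'h) tensor \<Rightarrow> ('k, 'l, 'h) tensor \<Rightarrow> ('k, 'l, 'h) tensor" where
  "dcp_mult H K la ra s t =
     tlift K H (\<lambda>a x. tlift K H (\<lambda>b y.
       sweedler H x (\<lambda>x1 x2. sweedler K b (\<lambda>b1 b2.
         tens K H (mult K a (la x1 b1)) (mult H (ra x2 b2) y)))) t) s"

definition double_cross_product ::
  "('k::field, 'h::ab_group_add, 'y) hopf_scheme \<Rightarrow> ('k, 'l::ab_group_add, 'z) hopf_scheme
    \<Rightarrow> ('h \<Rightarrow> 'l \<Rightarrow> 'l) \<Rightarrow> ('h \<Rightarrow> 'l \<Rightarrow> 'h) \<Rightarrow> ('k, ('k, 'l, 'h) tensor) hopf" where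
  "double_cross_product H K la ra =
     \<lparr>carrier = carrier (tensor_space K H),
      scale = scale (tensor_space K H),
      mult = dcp_mult H K la ra,
      one = tens K H (one K) (one H),
      comult = tlift K H (\<lambda>a x. sweedler K a (\<lambda>a1 a2. sweedler H x (\<lambda>x1 x2.
        tens (tensor_space K H) (tensor_space K H) (tens K H a1 x1) (tens K H a2 x2)))),
      counit = tlift K H (\<lambda>a x. counit K a * counit H x),
      antipode = tlift K H (\<lambda>a x.
        dcp_mult H K la ra (tens K H (one K) (antipode H x)) (tens K H (antipode K a) (one H)))\<rparr>"

definition incl_K ::
  "('k::field, 'h::ab_group_add, 'y) hopf_scheme \<Rightarrow> ('k, 'l::ab_group_add, 'z) hopf_scheme
    \<Rightarrow> 'l \<Rightarrow> ('k, 'l, 'h) tensor" where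
  "incl_K H K a = tens K H a (one H)"

definition incl_H ::
  "('k::field, 'h::ab_group_add, 'y) hopf_scheme \<Rightarrow> ('k, 'l::ab_group_add, 'z) hopf_scheme
    \<Rightarrow> 'h \<Rightarrow> ('k, 'l, 'h) tensor" where
  "incl_H H K x = tens K H (one K) x"


section \<open>Yetter-Drinfeld modules\<close>

record ('k, 'h, 'm) yd = "('k, 'm) vspace" +
  action :: "'h \<Rightarrow> 'm \<Rightarrow> 'm"
  coaction :: "'m \<Rightarrow> ('k, 'h, 'm) tensor"

definition yd_module ::
  "('k::field, 'h::ab_group_add, 'z) hopf_scheme \<Rightarrow> ('k, 'h, 'm::ab_group_add) yd \<Rightarrow> bool" where
  "yd_module H M \<longleftrightarrow>
     hopf_algebra H \<and> left_module H M (action M) \<and>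
     lin M (tensor_space H M) (coaction M) \<and>
     (\<forall>m\<in>carrier M.
        tlift H M (\<lambda>x m0. sweedler H x (\<lambda>x1 x2.
          tens H (tensor_space H M) x1 (tens H M x2 m0))) (coaction M m) =
        tlift H M (\<lambda>x m0. tens H (tensor_space H M) x (coaction M m0)) (coaction M m)) \<and>
     (\<forall>m\<in>carrier M. tlift H M (\<lambda>x m0. scale M (counit H x) m0) (coaction M m) = m) \<and>
     (\<forall>x\<in>carrier H. \<forall>m\<in>carrier M.
        coaction M (action M x m) =
        sweedler3 H x (\<lambda>x1 x2 x3. tlift H M (\<lambda>y m0.
          tens H M (mult H (mult H x1 y) (antipode H x3)) (action M x2 m0)) (coaction M m)))"

definition yd_hom ::
  "('k::field, 'h::ab_group_add, 'z) hopf_scheme \<Rightarrow> ('k, 'h, 'm::ab_group_add) yd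
    \<Rightarrow> ('k, 'h, 'n::ab_group_add) yd \<Rightarrow> ('m \<Rightarrow> 'n) \<Rightarrow> bool" where
  "yd_hom H M N f \<longleftrightarrow>
     lin M N f \<and>
     (\<forall>x\<in>carrier H. \<forall>m\<in>carrier M. f (action M x m) = action N x (f m)) \<and>
     (\<forall>m\<in>carrier M.
        coaction N (f m) = tlift H M (\<lambda>x m0. tens H N x (f m0)) (coaction M m))"

definition yd_tensor ::
  "('k::field, 'h::ab_group_add, 'z) hopf_scheme \<Rightarrow> ('k, 'h, 'm::ab_group_add) yd
    \<Rightarrow> ('k, 'h, 'n::ab_group_add) yd \<Rightarrow> ('k, 'h, ('k, 'm, 'n) tensor) yd" where
  "yd_tensor H M N =
     \<lparr>carrier = carrier (tensor_space M N),
      scale = scale (tensor_space M N),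
      action = (\<lambda>x. tlift M N (\<lambda>m n.
        sweedler H x (\<lambda>x1 x2. tens M N (action M x1 m) (action N x2 n)))),
      coaction = tlift M N (\<lambda>m n.
        tlift H M (\<lambda>x m0. tlift H N (\<lambda>y n0.
          tens H (tensor_space M N) (mult H x y) (tens M N m0 n0)) (coaction N n)) (coaction M m))\<rparr>"

definition yd_unit ::
  "('k::field, 'h::ab_group_add, 'z) hopf_scheme \<Rightarrow> ('k, 'h, 'k) yd" where
  "yd_unit H =
     \<lparr>carrier = carrier ground,
      scale = scale ground,
      action = (\<lambda>x c. counit H x * c),
      coaction = (\<lambda>c. tens H ground (one H) c)\<rparr>"

definition yd_object ::
  "('k::field, 'm::ab_group_add, 'z) hopf_scheme \<Rightarrow> ('h::ab_group_add \<Rightarrow> 'm \<Rightarrow> 'm)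
    \<Rightarrow> ('m \<Rightarrow> ('k, 'h, 'm) tensor) \<Rightarrow> ('k, 'h, 'm) yd" where
  "yd_object L act coact =
     \<lparr>carrier = carrier L, scale = scale L, action = act, coaction = coact\<rparr>"

text \<open>
  \<open>L\<close> with \<open>H\<close>-action \<open>act\<close> and \<open>H\<close>-coaction \<open>coact\<close> is a Hopf algebra in the category of
  Yetter-Drinfeld modules over \<open>H\<close>. In the last but one condition \<open>\<Delta>(ab)\<close> is
  \<open>a\<^sub>1 ((a\<^sub>2)\<^sub>-\<^sub>1 \<cdot> b\<^sub>1) \<otimes> (a\<^sub>2)\<^sub>0 b\<^sub>2\<close>, the product of the braided tensor square.
\<close>

definition yd_hopf_algebra ::
  "('k::field, 'h::ab_group_add, 'y) hopf_scheme \<Rightarrow> ('h \<Rightarrow> 'l::ab_group_add \<Rightarrow> 'l)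
    \<Rightarrow> ('l \<Rightarrow> ('k, 'h, 'l) tensor) \<Rightarrow> ('k, 'l, 'z) hopf_scheme \<Rightarrow> bool" where
  "yd_hopf_algebra H act coact L \<longleftrightarrow>
     (let M = yd_object L act coact in
       yd_module H M \<and> algebra L \<and> coalgebra L \<and>
       yd_hom H (yd_tensor H M M) M (tlift L L (mult L)) \<and>
       yd_hom H (yd_unit H) M (\<lambda>c. scale L c (one L)) \<and>
       yd_hom H M (yd_tensor H M M) (comult L) \<and>
       yd_hom H M (yd_unit H) (counit L) \<and>
       yd_hom H M M (antipode L) \<and>
       counit_algebra_map L \<and>
       comult L (one L) = tens L L (one L) (one L) \<and>
       (\<forall>a\<in>carrier L. \<forall>b\<in>carrier L.
          comult L (mult L a b) =
          sweedler L a (\<lambda>a1 a2. sweedler L b (\<lambda>b1 b2.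
            tlift H L (\<lambda>x a20. tens L L (mult L a1 (act x b1)) (mult L a20 b2)) (coact a2)))) \<and>
       convolution_inverse_id L)"


section \<open>Relative Rota-Baxter operators\<close>

definition Coad ::
  "('k::field, 'h::ab_group_add, 'y) hopf_scheme \<Rightarrow> ('k, 'l::ab_group_add, 'z) hopf_scheme
    \<Rightarrow> ('l \<Rightarrow> 'h) \<Rightarrow> 'l \<Rightarrow> ('k, 'h, 'l) tensor" where
  "Coad H L \<pi> a =
     sweedler3 L a (\<lambda>a1 a2 a3. tens H L (mult H (\<pi> a1) (antipode H (\<pi> a3))) a2)"

definition relative_rota_baxter ::
  "('k::field, 'h::ab_group_add, 'y) hopf_scheme \<Rightarrow> ('k, 'l::ab_group_add, 'z) hopf_scheme
    \<Rightarrow> ('h \<Rightarrow> 'l \<Rightarrow> 'l) \<Rightarrow> ('l \<Rightarrow> 'h) \<Rightarrow> bool" where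
  "relative_rota_baxter H L act \<pi> \<longleftrightarrow>
     hopf_algebra H \<and> yd_hopf_algebra H act (Coad H L \<pi>) L \<and> coalgebra_hom L H \<pi> \<and>
     (\<forall>a\<in>carrier L. \<forall>b\<in>carrier L.
        mult H (\<pi> a) (\<pi> b) = \<pi> (sweedler L a (\<lambda>a1 a2. mult L a1 (act (\<pi> a2) b))))"

text \<open>The structure \<open>K\<^sub>\<pi>\<close>; unit, coproduct and counit are those of \<open>K\<close>.\<close>

definition deformed ::
  "('k::field, 'l::ab_group_add) hopf \<Rightarrow> ('h \<Rightarrow> 'l \<Rightarrow> 'l) \<Rightarrow> ('l \<Rightarrow> 'h) \<Rightarrow> ('k, 'l) hopf" where
  "deformed K act \<pi> = K\<lparr>
     mult := (\<lambda>a b. sweedler K a (\<lambda>a1 a2. mult K a1 (act (\<pi> (antipode K a2)) b))),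
     antipode := (\<lambda>a. sweedler K a (\<lambda>a1 a2. act (\<pi> a1) (antipode K a2)))\<rparr>"

end

theory Submission
  imports Defs
begin

text \<open>
  The projection restricts to a bialgebra map \<open>\<pi> : K \<rightarrow> H\<close>, and applying \<open>\<theta>\<close> to \<open>(1 \<otimes> x)(b \<otimes> 1)\<close>
  gives \<open>x \<pi>(b) = \<pi>(x\<^sub>1 \<rightharpoonup> b\<^sub>1) (x\<^sub>2 \<leftharpoonup> b\<^sub>2)\<close>. This identity expresses the right action by the left one,
  \<open>(x \<leftharpoonup> a\<^sub>1) S(\<pi>(a\<^sub>2)) = S(\<pi>(x\<^sub>1 \<rightharpoonup> a)) x\<^sub>2\<close>, so that \<open>\<rightharpoonup>\<close> distributes over \<open>a \<bullet> b = a\<^sub>1 (S(\<pi>(a\<^sub>2)) \<rightharpoonup> b)\<close>.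
  The product of \<open>K\<close> is recovered as \<open>a b = a\<^sub>1 \<bullet> (\<pi>(a\<^sub>2) \<rightharpoonup> b)\<close>; this yields the Rota-Baxter identity and
  reduces associativity of \<open>\<bullet>\<close> to that of \<open>K\<close>. All other axioms are Sweedler computations.

  Such a computation \<open>s = t\<close> is organised around a third expression in which a product such as
  \<open>S(\<pi>(v\<^sub>1)) \<pi>(v\<^sub>2)\<close> is inserted: evaluating the product (rules \<open>eval\<close>) gives one side, and pulling all
  Sweedler sums to the outside (rules \<open>pull\<close>) gives the other.
\<close>


section \<open>Linear maps and Sweedler sums\<close>

lemma vspace_closed:
  assumes "is_vspace V"
  shows "0 \<in> carrier V"
    and "v \<in> carrier V \<Longrightarrow> w \<in> carrier V \<Longrightarrow> v + w \<in> carrier V"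
    and "v \<in> carrier V \<Longrightarrow> scale V c v \<in> carrier V"
proof -
  interpret vector_space "scale V" using assms by (simp add: is_vspace_def)
  have "subspace (carrier V)" using assms by (simp add: is_vspace_def)
  then show "0 \<in> carrier V"
    and "v \<in> carrier V \<Longrightarrow> w \<in> carrier V \<Longrightarrow> v + w \<in> carrier V"
    and "v \<in> carrier V \<Longrightarrow> scale V c v \<in> carrier V"
    by (auto simp: subspace_0 subspace_add subspace_scale)
qed

lemma linD:
  assumes "lin V W f"
  shows "v \<in> carrier V \<Longrightarrow> f v \<in> carrier W"
    and "v \<in> carrier V \<Longrightarrow> w \<in> carrier V \<Longrightarrow> f (v + w) = f v + f w"
    and "v \<in> carrier V \<Longrightarrow> f (scale V c v) = scale W c (f v)"
  using assms by (auto simp: lin_def)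

lemma lin_zero:
  assumes "is_vspace V" "lin V W f"
  shows "f 0 = 0"
  using linD(2)[OF assms(2), of 0 0] vspace_closed(1)[OF assms(1)] by simp

lemma vspace_scale:
  assumes "is_vspace V"
  shows "scale V c 0 = 0" "scale V 0 v = 0" "scale V 1 v = v"
    "scale V c (scale V d v) = scale V (c * d) v"
    "scale V c (v + w) = scale V c v + scale V c w"
    "scale V (c + d) v = scale V c v + scale V d v"
proof -
  interpret vector_space "scale V" using assms by (simp add: is_vspace_def)
  show "scale V c 0 = 0" "scale V 0 v = 0" "scale V 1 v = v"
    "scale V c (scale V d v) = scale V (c * d) v"
    "scale V c (v + w) = scale V c v + scale V c w"
    "scale V (c + d) v = scale V c v + scale V d v"
    by (simp_all add: scale_right_distrib scale_left_distrib)
qed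

lemma bilinI:
  assumes "\<And>v w. v \<in> carrier V \<Longrightarrow> w \<in> carrier W \<Longrightarrow> f v w \<in> carrier U"
    and "\<And>w. w \<in> carrier W \<Longrightarrow> lin V U (\<lambda>v. f v w)"
    and "\<And>v. v \<in> carrier V \<Longrightarrow> lin W U (f v)"
  shows "bilin V W U f"
  using assms by (auto simp: bilin_def)

lemma lin_cong:
  assumes "is_vspace V" "\<And>v. v \<in> carrier V \<Longrightarrow> f v = g v"
  shows "lin V W f \<longleftrightarrow> lin V W g"
  using assms vspace_closed[OF assms(1)] by (auto simp: lin_def)

lemma bilin_cong:
  assumes "is_vspace V" "is_vspace W"
    and "\<And>v w. v \<in> carrier V \<Longrightarrow> w \<in> carrier W \<Longrightarrow> f v w = g v w"
  shows "bilin V W U f \<longleftrightarrow> bilin V W U g"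
proof -
  have "lin W U (f v) \<longleftrightarrow> lin W U (g v)" if "v \<in> carrier V" for v
    by (rule lin_cong[OF assms(2)]) (rule assms(3)[OF that])
  moreover have "lin V U (\<lambda>v. f v w) \<longleftrightarrow> lin V U (\<lambda>v. g v w)" if "w \<in> carrier W" for w
    by (rule lin_cong[OF assms(1)]) (rule assms(3)[OF _ that])
  ultimately show ?thesis by (simp add: bilin_def)
qed

lemma lin_sum_list:
  assumes "is_vspace V" "lin V W g" "\<And>z. z \<in> set l \<Longrightarrow> f z \<in> carrier V"
  shows "(\<Sum>z\<leftarrow>l. f z) \<in> carrier V \<and> g (\<Sum>z\<leftarrow>l. f z) = (\<Sum>z\<leftarrow>l. g (f z))"
  using assms(3)
  by (induction l)
     (auto simp: lin_zero[OF assms(1,2)] vspace_closed[OF assms(1)] linD[OF assms(2)])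

lemma sum_list_lin:
  assumes W: "is_vspace W" and "\<And>z. z \<in> set l \<Longrightarrow> lin V W (f z)"
  shows "lin V W (\<lambda>v. \<Sum>z\<leftarrow>l. f z v)"
  using assms(2)
proof (induction l)
  case Nil
  then show ?case by (simp add: lin_def vspace_closed[OF W] vspace_scale[OF W])
next
  case (Cons z l)
  then have "lin V W (f z)" "lin V W (\<lambda>v. \<Sum>z\<leftarrow>l. f z v)" by auto
  then show ?case
    by (auto simp: lin_def vspace_scale[OF W] vspace_closed[OF W])
qed

section \<open>Chosen decompositions and linear maps on tensor products\<close>

lemma tensor_decomp:
  assumes V: "is_vspace V" and W: "is_vspace W" and t: "t \<in> carrier (tensor_space V W)"
  shows "set (decomposition V W t) \<subseteq> carrier V \<times> carrier W"
    and "t = (\<Sum>(v, w)\<leftarrow>decomposition V W t. tens V W v w)"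
proof -
  let ?P = "\<lambda>l. set l \<subseteq> carrier V \<times> carrier W \<and> t = (\<Sum>(v, w)\<leftarrow>l. tens V W v w)"
  have "?P (decomposition V W t)"
    unfolding decomposition_def using exists_decomposition[OF V W t] by (rule someI_ex)
  then show "set (decomposition V W t) \<subseteq> carrier V \<times> carrier W"
    and "t = (\<Sum>(v, w)\<leftarrow>decomposition V W t. tens V W v w)" by auto
qed

lemma tensor_ext:
  assumes V: "is_vspace V" and W: "is_vspace W"
    and f: "lin (tensor_space V W) U f" and g: "lin (tensor_space V W) U g"
    and eq: "\<And>v w. v \<in> carrier V \<Longrightarrow> w \<in> carrier W \<Longrightarrow> f (tens V W v w) = g (tens V W v w)"
    and t: "t \<in> carrier (tensor_space V W)"
  shows "f t = g t"
proof -
  let ?l = "decomposition V W t"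
  note d = tensor_decomp[OF V W t]
  have m: "(case z of (v, w) \<Rightarrow> tens V W v w) \<in> carrier (tensor_space V W)" if "z \<in> set ?l" for z
    using that d(1) by (auto intro!: tens_in_tensor_space)
  have "f (\<Sum>(v, w)\<leftarrow>?l. tens V W v w) = (\<Sum>z\<leftarrow>?l. f (case z of (v, w) \<Rightarrow> tens V W v w))"
    using lin_sum_list[OF is_vspace_tensor_space f, of ?l "\<lambda>(v, w). tens V W v w", OF m] by simp
  also have "\<dots> = (\<Sum>z\<leftarrow>?l. g (case z of (v, w) \<Rightarrow> tens V W v w))"
    using d(1) by (intro arg_cong[where f=sum_list] map_cong refl) (auto intro!: eq)
  also have "\<dots> = g (\<Sum>(v, w)\<leftarrow>?l. tens V W v w)"
    using lin_sum_list[OF is_vspace_tensor_space g, of ?l "\<lambda>(v, w). tens V W v w", OF m] by simp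
  finally show ?thesis using d(2) by simp
qed

text \<open>The chosen decomposition depends on \<open>t\<close> alone, so both sides sum over the
  same list, whose entries lie in the carriers.\<close>

lemma tlift_cong:
  assumes V: "is_vspace V" and W: "is_vspace W" and t: "t \<in> carrier (tensor_space V W)"
    and "\<And>v w. v \<in> carrier V \<Longrightarrow> w \<in> carrier W \<Longrightarrow> f v w = g v w"
  shows "tlift V W f t = tlift V W g t"
  unfolding tlift_def using tensor_decomp(1)[OF V W t] assms(4)
  by (intro arg_cong[where f=sum_list] map_cong refl) auto

lemma lin_comp:
  assumes "lin V W g" "lin X V f" shows "lin X W (\<lambda>x. g (f x))"
  using assms by (simp add: lin_def)

lemma lin_ident: "lin V V (\<lambda>x. x)"
  by (simp add: lin_def)

text \<open>Here \<open>t\<close> is fixed and the parameter enters through \<open>F\<close>, so one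
  decomposition serves every \<open>x\<close>. In \<open>lin_tlift_arg\<close> the tensor itself
  varies, and the bilinearity of \<open>F\<close> makes up for the changing decompositions.\<close>

lemma lin_tlift_body:
  assumes V: "is_vspace V" and W: "is_vspace W" and U: "is_vspace U"
    and t: "t \<in> carrier (tensor_space V W)"
    and F: "\<And>v w. v \<in> carrier V \<Longrightarrow> w \<in> carrier W \<Longrightarrow> lin X U (\<lambda>x. F x v w)"
  shows "lin X U (\<lambda>x. tlift V W (F x) t)"
  unfolding tlift_def using tensor_decomp(1)[OF V W t] F
  by (auto intro!: sum_list_lin[OF U] simp: case_prod_unfold)

lemma lin_tlift_arg:
  assumes "is_vspace V" "is_vspace W" "is_vspace U" "bilin V W U F"
    and "lin X (tensor_space V W) f"
  shows "lin X U (\<lambda>x. tlift V W F (f x))"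
  using lin_comp[OF lin_tlift[OF assms(1-4)] assms(5)] .

lemma lin_tens:
  assumes "is_vspace V" "is_vspace W"
  shows "lin X V f \<Longrightarrow> w \<in> carrier W \<Longrightarrow> lin X (tensor_space V W) (\<lambda>x. tens V W (f x) w)"
    and "lin X W g \<Longrightarrow> v \<in> carrier V \<Longrightarrow> lin X (tensor_space V W) (\<lambda>x. tens V W v (g x))"
  using bilin_tens[OF assms] by (auto simp: bilin_def intro: lin_comp)

lemma lin_bilin:
  assumes "bilin V W U F"
  shows "lin X V f \<Longrightarrow> w \<in> carrier W \<Longrightarrow> lin X U (\<lambda>x. F (f x) w)"
    and "lin X W g \<Longrightarrow> v \<in> carrier V \<Longrightarrow> lin X U (\<lambda>x. F v (g x))"
  using assms by (auto simp: bilin_def intro: lin_comp)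

lemma bilin_closed:
  "bilin V W U F \<Longrightarrow> v \<in> carrier V \<Longrightarrow> w \<in> carrier W \<Longrightarrow> F v w \<in> carrier U"
  by (auto simp: bilin_def lin_def)

lemma lin_scale_fun:
  assumes "is_vspace U" "lin X ground f" "u \<in> carrier U"
  shows "lin X U (\<lambda>x. scale U (f x) u)"
  using assms(2,3) by (auto simp: lin_def vspace_closed[OF assms(1)] vspace_scale[OF assms(1)] ground_def)

lemma lin_scale_const:
  assumes "is_vspace U" "lin X U f"
  shows "lin X U (\<lambda>x. scale U c (f x))"
  using assms(2)
  by (auto simp: lin_def vspace_closed[OF assms(1)] vspace_scale[OF assms(1)] mult.commute)

lemma lin_ground_mult:
  assumes "lin X ground f"
  shows "lin X ground (\<lambda>x. f x * c)" "lin X ground (\<lambda>x. c * f x)"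
  using assms by (auto simp: lin_def ground_def algebra_simps)

text \<open>The argument \<open>U\<close>, the space in which \<open>f\<close> takes its values, does not influence the value; it
  lets the simplifier infer the codomain in the linearity side conditions of the rules below.\<close>

definition sw ::
  "('k::field, 'a::ab_group_add, 'y) hopf_scheme \<Rightarrow> ('k, 'b::ab_group_add, 'z) vspace_scheme
    \<Rightarrow> 'a \<Rightarrow> ('a \<Rightarrow> 'a \<Rightarrow> 'b) \<Rightarrow> 'b" where
  "sw C U x f = (\<Sum>(v, w)\<leftarrow>filter (\<lambda>(v, w). v \<in> carrier C \<and> w \<in> carrier C)
     (decomposition C C (comult C x)). f v w)"

text \<open>The filter in \<open>sw\<close> keeps only summands from the carrier, whatever
  \<open>x\<close> is. Membership is therefore available under every Sweedler sum, and the
  simplifier can discharge the side conditions of rewriting there.\<close>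

lemma sw_cong [cong]:
  assumes "x = y" "\<And>v w. v \<in> carrier C \<Longrightarrow> w \<in> carrier C \<Longrightarrow> f v w = g v w"
  shows "sw C U x f = sw C U y g"
  unfolding sw_def assms(1) using assms(2)
  by (intro arg_cong[where f=sum_list] map_cong refl) auto

lemma sum_list_swap:
  "(\<Sum>x\<leftarrow>xs. \<Sum>y\<leftarrow>ys. f x y) = (\<Sum>y\<leftarrow>ys. \<Sum>x\<leftarrow>xs. (f x y :: 'a::comm_monoid_add))"
  by (induction xs) (simp_all add: sum_list_addf)

text \<open>The lists of summands come from \<open>x\<close> and \<open>y\<close> alone, so these
  are two independent finite sums.\<close>

lemma sw_swap:
  "sw C U x (\<lambda>x1 x2. sw D U' y (\<lambda>y1 y2. f x1 x2 y1 y2)) =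
   sw D U' y (\<lambda>y1 y2. sw C U x (\<lambda>x1 x2. f x1 x2 y1 y2))"
  unfolding sw_def case_prod_unfold by (rule sum_list_swap)

lemma sw_pull:
  assumes "is_vspace V" "lin V W g"
    and "\<And>v w. v \<in> carrier C \<Longrightarrow> w \<in> carrier C \<Longrightarrow> f v w \<in> carrier V"
  shows "g (sw C V x f) = sw C W x (\<lambda>x1 x2. g (f x1 x2))"
    and "sw C V x f \<in> carrier V"
proof -
  let ?l = "filter (\<lambda>p. fst p \<in> carrier C \<and> snd p \<in> carrier C) (decomposition C C (comult C x))"
  have "f (fst z) (snd z) \<in> carrier V" if "z \<in> set ?l" for z
    using that assms(3) by simp
  from lin_sum_list[OF assms(1,2), of ?l "\<lambda>z. f (fst z) (snd z)", OF this]
  show "g (sw C V x f) = sw C W x (\<lambda>x1 x2. g (f x1 x2))" and "sw C V x f \<in> carrier V"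
    unfolding sw_def case_prod_unfold by simp_all
qed

lemma sw_closed:
  assumes "is_vspace V" "\<And>v w. v \<in> carrier C \<Longrightarrow> w \<in> carrier C \<Longrightarrow> f v w \<in> carrier V"
  shows "sw C V x f \<in> carrier V"
  using sw_pull(2)[OF assms(1) lin_ident assms(2)] .

lemma lin_sw_body:
  assumes "is_vspace U"
    and F: "\<And>v w. v \<in> carrier C \<Longrightarrow> w \<in> carrier C \<Longrightarrow> lin X U (\<lambda>x. F x v w)"
  shows "lin X U (\<lambda>x. sw C U y (F x))"
  unfolding sw_def case_prod_unfold using F
  by (auto intro!: sum_list_lin[OF assms(1)])

lemma sw_eq_sweedler:
  assumes "coalgebra C" "x \<in> carrier C"
  shows "sweedler C x f = sw C U x f"
proof -
  have V: "is_vspace C" and t: "comult C x \<in> carrier (tensor_space C C)"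
    using assms by (auto simp: coalgebra_def lin_def)
  from tensor_decomp(1)[OF V V t]
  show ?thesis unfolding sweedler_def tlift_def sw_def
    by (subst filter_True) auto
qed

lemma comult_eq_sw:
  assumes "coalgebra C" "x \<in> carrier C"
  shows "comult C x = sw C (tensor_space C C) x (tens C C)"
proof -
  have V: "is_vspace C" and t: "comult C x \<in> carrier (tensor_space C C)"
    using assms by (auto simp: coalgebra_def lin_def)
  from tensor_decomp[OF V V t]
  show ?thesis unfolding sw_def
    by (subst filter_True) auto
qed

lemma sw_eq_tlift:
  assumes "coalgebra C" "x \<in> carrier C"
  shows "sw C U x f = tlift C C f (comult C x)"
  by (subst sw_eq_sweedler[OF assms, symmetric]) (simp add: sweedler_def)

lemma tlift_sw:
  assumes VW: "is_vspace V" "is_vspace W" and U: "is_vspace U" and F: "bilin V W U F"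
    and "\<And>x1 x2. x1 \<in> carrier C \<Longrightarrow> x2 \<in> carrier C \<Longrightarrow> f x1 x2 \<in> carrier (tensor_space V W)"
  shows "tlift V W F (sw C (tensor_space V W) x f) = sw C U x (\<lambda>x1 x2. tlift V W F (f x1 x2))"
  by (rule sw_pull(1)[OF is_vspace_tensor_space lin_tlift[OF VW U F] assms(5)])

text \<open>The decomposition of the coproduct varies with \<open>x\<close>; linearity comes from
  writing the sum as \<open>tlift\<close> applied to \<open>comult\<close>.\<close>

lemma lin_sw_arg:
  assumes C: "coalgebra C" and U: "is_vspace U" and X: "is_vspace X" and f: "lin X C f"
    and F: "\<And>y. y \<in> carrier C \<Longrightarrow> lin C U (\<lambda>x. F x y)" "\<And>x. x \<in> carrier C \<Longrightarrow> lin C U (\<lambda>y. F x y)"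
  shows "lin X U (\<lambda>x. sw C U (f x) F)"
proof -
  have V: "is_vspace C" and t: "lin C (tensor_space C C) (comult C)"
    using C by (auto simp: coalgebra_def)
  have B: "bilin C C U F" using F by (auto simp: bilin_def)
  have "lin X U (\<lambda>x. tlift C C F (comult C (f x)))"
    by (rule lin_tlift_arg[OF V V U B lin_comp[OF t f]])
  then show ?thesis
    by (subst lin_cong[OF X, of _ "\<lambda>x. tlift C C F (comult C (f x))"])
       (auto simp: sw_eq_tlift[OF C] linD[OF f])
qed

text \<open>Turns a formula for a coproduct into a rewrite rule for all Sweedler sums.
  Multiplicativity of the coproduct and the coalgebra map axioms enter the calculus this
  way.\<close>

lemma sw_eqI:
  assumes "coalgebra C" "x \<in> carrier C" "is_vspace U"
    and eq: "comult C x = sw D (tensor_space C C) y (\<lambda>y1 y2. t y1 y2)"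
    and t: "\<And>x1 x2. x1 \<in> carrier D \<Longrightarrow> x2 \<in> carrier D \<Longrightarrow> t x1 x2 \<in> carrier (tensor_space C C)"
    and F: "\<And>y. y \<in> carrier C \<Longrightarrow> lin C U (\<lambda>x. F x y)" "\<And>x. x \<in> carrier C \<Longrightarrow> lin C U (\<lambda>y. F x y)"
  shows "sw C U x F = sw D U y (\<lambda>y1 y2. tlift C C F (t y1 y2))"
proof -
  have V: "is_vspace C" using assms by (auto simp: coalgebra_def)
  have B: "bilin C C U F" using F by (auto simp: bilin_def)
  show ?thesis unfolding sw_eq_tlift[OF assms(1,2)] eq
    by (rule tlift_sw[OF V V assms(3) B t])
qed

text \<open>The axiom is an equation in C \<otimes> (C \<otimes> C). Applying the linear map induced
  by the trilinear \<open>F\<close> gives it for arbitrary summands.\<close>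

lemma coassoc:
  assumes C: "coalgebra C" and x: "x \<in> carrier C" and U: "is_vspace U"
    and F: "\<And>y z. y \<in> carrier C \<Longrightarrow> z \<in> carrier C \<Longrightarrow> lin C U (\<lambda>x. F x y z)"
      "\<And>x z. x \<in> carrier C \<Longrightarrow> z \<in> carrier C \<Longrightarrow> lin C U (\<lambda>y. F x y z)"
      "\<And>x y. x \<in> carrier C \<Longrightarrow> y \<in> carrier C \<Longrightarrow> lin C U (\<lambda>z. F x y z)"
  shows "sw C U x (\<lambda>x1 x2. sw C U x1 (\<lambda>u v. F u v x2)) =
    sw C U x (\<lambda>u r. sw C U r (\<lambda>v w. F u v w))"
proof -
  let ?T = "tensor_space C C" let ?T3 = "tensor_space C ?T"
  have V: "is_vspace C" using C by (auto simp: coalgebra_def)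
  note T = is_vspace_tensor_space[of C C]
  have Cc: "comult C x \<in> carrier ?T" if "x \<in> carrier C" for x
    using C that by (auto simp: coalgebra_def lin_def)
  have cF: "F x y z \<in> carrier U" if "x \<in> carrier C" "y \<in> carrier C" "z \<in> carrier C" for x y z
    using F(1) that by (auto simp: lin_def)
  have B1: "bilin C C U (F x)" if "x \<in> carrier C" for x
    using F that by (auto simp: bilin_def)
  have B2: "bilin C ?T U (\<lambda>x. tlift C C (F x))"
  proof (rule bilinI)
    fix v assume v: "v \<in> carrier C"
    show *: "lin ?T U (tlift C C (F v))" by (rule lin_tlift[OF V V U B1[OF v]])
    fix w assume "w \<in> carrier ?T"
    then show "tlift C C (F v) w \<in> carrier U" by (rule linD(1)[OF *])
  next
    fix w assume w: "w \<in> carrier ?T"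
    show "lin C U (\<lambda>v. tlift C C (F v) w)"
      by (rule lin_tlift_body[OF V V U w F(1)])
  qed
  have G: "lin ?T3 U (tlift C ?T (\<lambda>x. tlift C C (F x)))"
    by (rule lin_tlift[OF V T U B2])
  have ev: "tlift C ?T (\<lambda>x. tlift C C (F x)) (tens C ?T a (tens C C b c)) = F a b c"
    if "a \<in> carrier C" "b \<in> carrier C" "c \<in> carrier C" for a b c
    using that B1 tens_in_tensor_space[of b C c C]
    by (simp add: tlift_tens[OF V T U B2] tlift_tens[OF V V U])
  have ev': "tlift C ?T (\<lambda>x. tlift C C (F x)) (tens C ?T a (comult C b)) = sw C U b (F a)"
    if "a \<in> carrier C" "b \<in> carrier C" for a b
    using that Cc by (simp add: tlift_tens[OF V T U B2] sw_eq_tlift[OF C])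
  \<comment> \<open>\<open>F\<close> is written as the induced map on a pure tensor, and the map is
    then drawn out of both sums so that the axiom applies to its argument.\<close>
  have "sw C U x (\<lambda>x1 x2. sw C U x1 (\<lambda>u v. F u v x2)) =
    sw C U x (\<lambda>x1 x2. sw C U x1 (\<lambda>u v. tlift C ?T (\<lambda>x. tlift C C (F x)) (tens C ?T u (tens C C v x2))))"
    by (simp add: ev)
  also have "\<dots> = sw C U x (\<lambda>x1 x2. tlift C ?T (\<lambda>x. tlift C C (F x)) (sw C ?T3 x1 (\<lambda>u v. (tens C ?T u (tens C C v x2)))))"
    by (intro sw_cong refl sw_pull(1)[OF is_vspace_tensor_space G, symmetric] tens_in_tensor_space)
  also have "\<dots> = tlift C ?T (\<lambda>x. tlift C C (F x)) (sw C ?T3 x (\<lambda>x1 x2. sw C ?T3 x1 (\<lambda>u v. (tens C ?T u (tens C C v x2)))))"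
    by (intro sw_cong refl sw_pull(1)[OF is_vspace_tensor_space G, symmetric] tens_in_tensor_space sw_closed is_vspace_tensor_space)
  also have "sw C ?T3 x (\<lambda>x1 x2. sw C ?T3 x1 (\<lambda>u v. (tens C ?T u (tens C C v x2)))) =
     sweedler C x (\<lambda>x1 x2. sweedler C x1 (\<lambda>u v. (tens C ?T u (tens C C v x2))))"
    by (simp add: sw_eq_sweedler[OF C, where U="?T3"] x)
  also have "\<dots> = sweedler C x (\<lambda>x1 x2. tens C ?T x1 (comult C x2))"
    using C x unfolding coalgebra_def by blast
  also have "\<dots> = sw C ?T3 x (\<lambda>x1 x2. tens C ?T x1 (comult C x2))"
    by (simp add: sw_eq_sweedler[OF C, where U="?T3"] x)
  also have "tlift C ?T (\<lambda>x. tlift C C (F x)) \<dots> = sw C U x (\<lambda>x1 x2. tlift C ?T (\<lambda>x. tlift C C (F x)) (tens C ?T x1 (comult C x2)))"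
    by (intro sw_cong refl sw_pull(1)[OF is_vspace_tensor_space G] tens_in_tensor_space Cc)
  also have "\<dots> = sw C U x (\<lambda>u r. sw C U r (\<lambda>v w. F u v w))"
    by (simp add: ev')
  finally show ?thesis .
qed

lemma sw_counit:
  assumes C: "coalgebra C" and x: "x \<in> carrier C" and F: "lin C U F"
  shows "sw C U x (\<lambda>x1 x2. scale U (counit C x1) (F x2)) = F x"
    and "sw C U x (\<lambda>x1 x2. scale U (counit C x2) (F x1)) = F x"
proof -
  have V: "is_vspace C" using C by (simp add: coalgebra_def)
  have e: "sw C C x (\<lambda>x1 x2. scale C (counit C x1) x2) = x"
    "sw C C x (\<lambda>x1 x2. scale C (counit C x2) x1) = x"
    using C x by (auto simp: coalgebra_def sw_eq_sweedler[OF C, where U=C, symmetric])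
  note pull = sw_pull(1)[OF V F, of C]
  have "F x = F (sw C C x (\<lambda>x1 x2. scale C (counit C x1) x2))" using e by simp
  also have "\<dots> = sw C U x (\<lambda>x1 x2. F (scale C (counit C x1) x2))"
    by (rule pull) (simp add: vspace_closed[OF V])
  finally show "sw C U x (\<lambda>x1 x2. scale U (counit C x1) (F x2)) = F x"
    by (simp add: linD[OF F])
  have "F x = F (sw C C x (\<lambda>x1 x2. scale C (counit C x2) x1))" using e by simp
  also have "\<dots> = sw C U x (\<lambda>x1 x2. F (scale C (counit C x2) x1))"
    by (rule pull) (simp add: vspace_closed[OF V])
  finally show "sw C U x (\<lambda>x1 x2. scale U (counit C x2) (F x1)) = F x"
    by (simp add: linD[OF F])
qed


section \<open>Sweedler calculus in Hopf algebras\<close>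

lemma is_vspace_ts [simp]: "is_vspace (tensor_space V W)"
  by (rule is_vspace_tensor_space)

lemma is_vspace_gr [simp]: "is_vspace ground"
  by (rule is_vspace_ground)

lemmas [simp] = lin_ident lin_tens lin_sw_body sw_closed tens_in_tensor_space

lemma scale_mult [simp]: "is_vspace V \<Longrightarrow> scale V (c * d) v = scale V c (scale V d v)"
  by (simp add: vspace_scale(4))

lemma scale_one [simp]: "is_vspace V \<Longrightarrow> scale V 1 v = v"
  by (simp add: vspace_scale)

lemma scale_closed [simp]: "is_vspace V \<Longrightarrow> v \<in> carrier V \<Longrightarrow> scale V c v \<in> carrier V"
  by (simp add: vspace_closed)

lemma ground_scale: "scale ground c d = c * d" "c \<in> carrier ground"
  by (simp_all add: ground_def)

lemma lin_scale_fun' [simp]: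
  "is_vspace U \<Longrightarrow> lin X ground f \<Longrightarrow> u \<in> carrier U \<Longrightarrow> lin X U (\<lambda>x. scale U (f x) u)"
  "is_vspace U \<Longrightarrow> lin X U g \<Longrightarrow> lin X U (\<lambda>x. scale U c (g x))"
  by (simp_all add: lin_scale_fun lin_scale_const)

text \<open>The rules that the simplifier needs for one linear map; instantiating them for each
  structure map provides closure, linearity in a parameter and commutation with sums.\<close>

lemma lin_app:
  assumes "is_vspace V" "lin V W g"
  shows "v \<in> carrier V \<Longrightarrow> g v \<in> carrier W"
    and "lin X V f \<Longrightarrow> lin X W (\<lambda>x. g (f x))"
    and "v \<in> carrier V \<Longrightarrow> g (scale V c v) = scale W c (g v)"
    and "(\<And>v w. v \<in> carrier C \<Longrightarrow> w \<in> carrier C \<Longrightarrow> F v w \<in> carrier V) \<Longrightarrow>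
      g (sw C V x F) = sw C W x (\<lambda>x1 x2. g (F x1 x2))"
  by (rule linD(1)[OF assms(2)] lin_comp[OF assms(2)] linD(3)[OF assms(2)] sw_pull(1)[OF assms]; assumption)+

lemma bilin_app:
  assumes "is_vspace V" "is_vspace W" "bilin V W U g"
  shows "v \<in> carrier V \<Longrightarrow> w \<in> carrier W \<Longrightarrow> g v w \<in> carrier U"
    and "lin X V f \<Longrightarrow> w \<in> carrier W \<Longrightarrow> lin X U (\<lambda>x. g (f x) w)"
    and "lin X W f' \<Longrightarrow> v \<in> carrier V \<Longrightarrow> lin X U (\<lambda>x. g v (f' x))"
    and "v \<in> carrier V \<Longrightarrow> w \<in> carrier W \<Longrightarrow> g (scale V c v) w = scale U c (g v w)"
    and "v \<in> carrier V \<Longrightarrow> w \<in> carrier W \<Longrightarrow> g v (scale W c w) = scale U c (g v w)"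
    and "(\<And>v w. v \<in> carrier C \<Longrightarrow> w \<in> carrier C \<Longrightarrow> F v w \<in> carrier V) \<Longrightarrow> w \<in> carrier W \<Longrightarrow>
      g (sw C V x F) w = sw C U x (\<lambda>x1 x2. g (F x1 x2) w)"
    and "(\<And>v w. v \<in> carrier D \<Longrightarrow> w \<in> carrier D \<Longrightarrow> F' v w \<in> carrier W) \<Longrightarrow> v \<in> carrier V \<Longrightarrow>
      g v (sw D W x F') = sw D U x (\<lambda>x1 x2. g v (F' x1 x2))"
proof -
  have 1: "lin V U (\<lambda>v. g v w)" if "w \<in> carrier W" for w
    using assms(3) that by (simp add: bilin_def)
  have 2: "lin W U (g v)" if "v \<in> carrier V" for v
    using assms(3) that by (simp add: bilin_def)
  show "v \<in> carrier V \<Longrightarrow> w \<in> carrier W \<Longrightarrow> g v w \<in> carrier U"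
    and "lin X V f \<Longrightarrow> w \<in> carrier W \<Longrightarrow> lin X U (\<lambda>x. g (f x) w)"
    and "lin X W f' \<Longrightarrow> v \<in> carrier V \<Longrightarrow> lin X U (\<lambda>x. g v (f' x))"
    by (rule bilin_closed[OF assms(3)] lin_bilin[OF assms(3)]; assumption)+
  show "v \<in> carrier V \<Longrightarrow> w \<in> carrier W \<Longrightarrow> g (scale V c v) w = scale U c (g v w)"
    by (rule linD(3)[OF 1])
  show "v \<in> carrier V \<Longrightarrow> w \<in> carrier W \<Longrightarrow> g v (scale W c w) = scale U c (g v w)"
    by (rule linD(3)[OF 2])
  show "(\<And>v w. v \<in> carrier C \<Longrightarrow> w \<in> carrier C \<Longrightarrow> F v w \<in> carrier V) \<Longrightarrow> w \<in> carrier W \<Longrightarrow>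
      g (sw C V x F) w = sw C U x (\<lambda>x1 x2. g (F x1 x2) w)"
    by (rule sw_pull(1)[OF assms(1) 1])
  show "(\<And>v w. v \<in> carrier D \<Longrightarrow> w \<in> carrier D \<Longrightarrow> F' v w \<in> carrier W) \<Longrightarrow> v \<in> carrier V \<Longrightarrow>
      g v (sw D W x F') = sw D U x (\<lambda>x1 x2. g v (F' x1 x2))"
    by (rule sw_pull(1)[OF assms(2) 2])
qed

lemma tens_app [simp]:
  assumes "is_vspace V" "is_vspace W"
  shows "v \<in> carrier V \<Longrightarrow> w \<in> carrier W \<Longrightarrow> tens V W (scale V c v) w = scale (tensor_space V W) c (tens V W v w)"
    and "v \<in> carrier V \<Longrightarrow> w \<in> carrier W \<Longrightarrow> tens V W v (scale W c w) = scale (tensor_space V W) c (tens V W v w)"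
    and "(\<And>v w. v \<in> carrier C \<Longrightarrow> w \<in> carrier C \<Longrightarrow> F v w \<in> carrier V) \<Longrightarrow> w \<in> carrier W \<Longrightarrow>
      tens V W (sw C V x F) w = sw C (tensor_space V W) x (\<lambda>x1 x2. tens V W (F x1 x2) w)"
    and "(\<And>v w. v \<in> carrier D \<Longrightarrow> w \<in> carrier D \<Longrightarrow> F' v w \<in> carrier W) \<Longrightarrow> v \<in> carrier V \<Longrightarrow>
      tens V W v (sw D W x F') = sw D (tensor_space V W) x (\<lambda>x1 x2. tens V W v (F' x1 x2))"
  by (rule bilin_app(4-7)[OF assms bilin_tens[OF assms]]; assumption)+

lemma sw_scale_const [simp]:
  assumes "is_vspace U" "\<And>v w. v \<in> carrier C \<Longrightarrow> w \<in> carrier C \<Longrightarrow> F v w \<in> carrier U"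
  shows "sw C U x (\<lambda>x1 x2. scale U c (F x1 x2)) = scale U c (sw C U x F)"
  by (rule sw_pull(1)[OF assms(1) lin_scale_const[OF assms(1) lin_ident] assms(2), symmetric])

text \<open>The normal form under \<open>pull\<close> nests the sums over an iterated coproduct to the right and keeps
  those of one element adjacent. Higher-order patterns have fixed depth, so separate rules are
  needed for 0 to 3 unrelated sums in between.\<close>

lemma sw_group:
  "sw C U x (\<lambda>x1 r. sw C U (y x1) (\<lambda>y1 s. sw C U r (\<lambda>v w. F x1 y1 s v w))) =
   sw C U x (\<lambda>x1 r. sw C U r (\<lambda>v w. sw C U (y x1) (\<lambda>y1 s. F x1 y1 s v w)))"
  by (rule sw_cong[OF refl], rule sw_swap)

lemma sw_group3:
  "sw C U x (\<lambda>x1 r. sw C U y (\<lambda>y1 s. sw C U (z y1 s) (\<lambda>z1 z2. sw C U r (\<lambda>v w. F x1 y1 s z1 z2 v w)))) =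
   sw C U x (\<lambda>x1 r. sw C U r (\<lambda>v w. sw C U y (\<lambda>y1 s. sw C U (z y1 s) (\<lambda>z1 z2. F x1 y1 s z1 z2 v w))))"
  by (subst sw_swap[of _ _ "z _ _"], subst sw_swap[of _ _ y]) (rule refl)

named_theorems pull
named_theorems eval

section \<open>The calculus of a single Hopf algebra\<close>

locale hopf_alg =
  fixes A :: "('k::field, 'a::ab_group_add) hopf"
  assumes hopf: "hopf_algebra A"
begin

lemma alg: "algebra A" and coalg: "coalgebra A" and vs [simp]: "is_vspace A"
  using hopf by (auto simp: hopf_algebra_def algebra_def)

lemma mult_bilin: "bilin A A A (mult A)"
  and S_lin: "lin A A (antipode A)"
  and eps_lin: "lin A ground (counit A)"
  using hopf by (auto simp: hopf_algebra_def algebra_def coalgebra_def convolution_inverse_id_def)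

lemmas mult_simps [simp] = bilin_app[OF vs vs mult_bilin]
lemmas S_simps [simp] = lin_app[OF vs S_lin]
lemmas eps_simps [simp] = lin_app(2,4)[OF vs eps_lin]

lemma one_closed [simp]: "one A \<in> carrier A"
  and mult_one [simp]: "x \<in> carrier A \<Longrightarrow> mult A (one A) x = x"
    "x \<in> carrier A \<Longrightarrow> mult A x (one A) = x"
  and mult_assoc [simp]: "x \<in> carrier A \<Longrightarrow> y \<in> carrier A \<Longrightarrow> z \<in> carrier A \<Longrightarrow>
    mult A (mult A x y) z = mult A x (mult A y z)"
  using alg by (auto simp: algebra_def)

lemma eps_one [simp]: "counit A (one A) = 1"
  and eps_mult [simp]: "x \<in> carrier A \<Longrightarrow> y \<in> carrier A \<Longrightarrow>
    counit A (mult A x y) = counit A x * counit A y"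
  and eps_scale [simp]: "x \<in> carrier A \<Longrightarrow> counit A (scale A c x) = c * counit A x"
  using hopf lin_app(3)[OF vs eps_lin]
  by (auto simp: hopf_algebra_def counit_algebra_map_def ground_scale)

lemma lin_sw_arg' [simp]:
  "is_vspace U \<Longrightarrow> is_vspace X \<Longrightarrow> lin X A f \<Longrightarrow>
   (\<And>y. y \<in> carrier A \<Longrightarrow> lin A U (\<lambda>x. F x y)) \<Longrightarrow> (\<And>x. x \<in> carrier A \<Longrightarrow> lin A U (\<lambda>y. F x y)) \<Longrightarrow>
   lin X U (\<lambda>x. sw A U (f x) F)"
  by (rule lin_sw_arg[OF coalg])

lemma sw_counit' [simp]:
  "x \<in> carrier A \<Longrightarrow> lin A U F \<Longrightarrow> sw A U x (\<lambda>x1 x2. scale U (counit A x1) (F x2)) = F x"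
  "x \<in> carrier A \<Longrightarrow> lin A U F \<Longrightarrow> sw A U x (\<lambda>x1 x2. scale U (counit A x2) (F x1)) = F x"
  by (rule sw_counit[OF coalg]; assumption)+

lemmas sw_coassoc [pull] = coassoc[OF coalg]
lemmas [pull] = sw_group[of A] sw_group3[of A]

text \<open>The intervening sum may depend on \<open>x2\<close> but not on the parts of
  \<open>x1\<close>, so it can be swapped with the inner coproduct. The versions with more
  intervening sums reduce to this one in the same way.\<close>

lemma sw_coassoc2 [pull]:
  assumes "x \<in> carrier A" "is_vspace U"
    and "\<And>v z y1 y2. v \<in> carrier A \<Longrightarrow> z \<in> carrier A \<Longrightarrow> lin A U (\<lambda>u. sw D U (y z) (\<lambda>y1 y2. F u v z y1 y2))"
      "\<And>u z y1 y2. u \<in> carrier A \<Longrightarrow> z \<in> carrier A \<Longrightarrow> lin A U (\<lambda>v. sw D U (y z) (\<lambda>y1 y2. F u v z y1 y2))"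
      "\<And>u v. u \<in> carrier A \<Longrightarrow> v \<in> carrier A \<Longrightarrow> lin A U (\<lambda>z. sw D U (y z) (\<lambda>y1 y2. F u v z y1 y2))"
  shows "sw A U x (\<lambda>x1 x2. sw D U (y x2) (\<lambda>y1 y2. sw A U x1 (\<lambda>u v. F u v x2 y1 y2))) =
    sw A U x (\<lambda>u r. sw A U r (\<lambda>v x2. sw D U (y x2) (\<lambda>y1 y2. F u v x2 y1 y2)))"
  by (subst sw_swap) (rule sw_coassoc[OF assms])

lemma sw_coassoc3 [pull]:
  assumes "x \<in> carrier A" "is_vspace U"
    and "\<And>v z y1 y2. v \<in> carrier A \<Longrightarrow> z \<in> carrier A \<Longrightarrow>
        lin A U (\<lambda>u. sw D U (y z) (\<lambda>y1 y2. sw E U (t z y1 y2) (\<lambda>t1 t2. F u v z y1 y2 t1 t2)))"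
      "\<And>u z y1 y2. u \<in> carrier A \<Longrightarrow> z \<in> carrier A \<Longrightarrow>
        lin A U (\<lambda>v. sw D U (y z) (\<lambda>y1 y2. sw E U (t z y1 y2) (\<lambda>t1 t2. F u v z y1 y2 t1 t2)))"
      "\<And>u v. u \<in> carrier A \<Longrightarrow> v \<in> carrier A \<Longrightarrow>
        lin A U (\<lambda>z. sw D U (y z) (\<lambda>y1 y2. sw E U (t z y1 y2) (\<lambda>t1 t2. F u v z y1 y2 t1 t2)))"
  shows "sw A U x (\<lambda>x1 x2. sw D U (y x2) (\<lambda>y1 y2. sw E U (t x2 y1 y2) (\<lambda>t1 t2.
      sw A U x1 (\<lambda>u v. F u v x2 y1 y2 t1 t2)))) =
    sw A U x (\<lambda>u r. sw A U r (\<lambda>v x2. sw D U (y x2) (\<lambda>y1 y2. sw E U (t x2 y1 y2)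
      (\<lambda>t1 t2. F u v x2 y1 y2 t1 t2))))"
  by (subst sw_swap[of _ _ "t _ _ _"]) (rule sw_coassoc2[OF assms])

lemma sw_coassoc4 [pull]:
  assumes "x \<in> carrier A" "is_vspace U"
    and "\<And>v z. v \<in> carrier A \<Longrightarrow> z \<in> carrier A \<Longrightarrow>
        lin A U (\<lambda>u. sw D U (y z) (\<lambda>y1 y2. sw E U (t z y1 y2) (\<lambda>t1 t2. sw B U (s z y1 y2 t1 t2)
          (\<lambda>s1 s2. F u v z y1 y2 t1 t2 s1 s2))))"
      "\<And>u z. u \<in> carrier A \<Longrightarrow> z \<in> carrier A \<Longrightarrow>
        lin A U (\<lambda>v. sw D U (y z) (\<lambda>y1 y2. sw E U (t z y1 y2) (\<lambda>t1 t2. sw B U (s z y1 y2 t1 t2)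
          (\<lambda>s1 s2. F u v z y1 y2 t1 t2 s1 s2))))"
      "\<And>u v. u \<in> carrier A \<Longrightarrow> v \<in> carrier A \<Longrightarrow>
        lin A U (\<lambda>z. sw D U (y z) (\<lambda>y1 y2. sw E U (t z y1 y2) (\<lambda>t1 t2. sw B U (s z y1 y2 t1 t2)
          (\<lambda>s1 s2. F u v z y1 y2 t1 t2 s1 s2))))"
  shows "sw A U x (\<lambda>x1 x2. sw D U (y x2) (\<lambda>y1 y2. sw E U (t x2 y1 y2) (\<lambda>t1 t2.
      sw B U (s x2 y1 y2 t1 t2) (\<lambda>s1 s2. sw A U x1 (\<lambda>u v. F u v x2 y1 y2 t1 t2 s1 s2))))) =
    sw A U x (\<lambda>u r. sw A U r (\<lambda>v x2. sw D U (y x2) (\<lambda>y1 y2. sw E U (t x2 y1 y2)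
      (\<lambda>t1 t2. sw B U (s x2 y1 y2 t1 t2) (\<lambda>s1 s2. F u v x2 y1 y2 t1 t2 s1 s2)))))"
  by (subst sw_swap[of _ _ "s _ _ _ _ _"]) (rule sw_coassoc3[OF assms])

lemma sw_eq: "x \<in> carrier A \<Longrightarrow> sweedler A x f = sw A U x f"
  by (rule sw_eq_sweedler[OF coalg])

lemma comult_sw: "x \<in> carrier A \<Longrightarrow> comult A x = sw A (tensor_space A A) x (tens A A)"
  by (rule comult_eq_sw[OF coalg])

lemma antipode_l [eval]: "x \<in> carrier A \<Longrightarrow>
    sw A A x (\<lambda>x1 x2. mult A (antipode A x1) x2) = scale A (counit A x) (one A)"
  and antipode_r [eval]: "x \<in> carrier A \<Longrightarrow>
    sw A A x (\<lambda>x1 x2. mult A x1 (antipode A x2)) = scale A (counit A x) (one A)"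
  using hopf by (auto simp: hopf_algebra_def convolution_inverse_id_def sw_eq[of _ _ A, symmetric])

lemma sw_one [simp]:
  assumes "is_vspace U" "\<And>y. y \<in> carrier A \<Longrightarrow> lin A U (\<lambda>x. F x y)" "\<And>x. x \<in> carrier A \<Longrightarrow> lin A U (\<lambda>y. F x y)"
  shows "sw A U (one A) F = F (one A) (one A)"
proof -
  have "bilin A A U F" using assms by (simp add: bilin_def)
  from tlift_tens[OF vs vs assms(1) this] show ?thesis
    using hopf by (simp add: sw_eq_tlift[OF coalg] hopf_algebra_def)
qed

lemma sw_lin [simp]:
  assumes "is_vspace U" "\<And>y. y \<in> carrier A \<Longrightarrow> lin A U (\<lambda>x. F x y)" "\<And>x. x \<in> carrier A \<Longrightarrow> lin A U (\<lambda>y. F x y)"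
  shows "x \<in> carrier A \<Longrightarrow> sw A U (scale A c x) F = scale U c (sw A U x F)"
    and "(\<And>v w. v \<in> carrier D \<Longrightarrow> w \<in> carrier D \<Longrightarrow> f v w \<in> carrier A) \<Longrightarrow>
      sw A U (sw D A z f) F = sw D U z (\<lambda>z1 z2. sw A U (f z1 z2) F)"
  by (rule lin_app(3,4)[OF vs lin_sw_arg'[OF assms(1) vs lin_ident assms(2,3)]]; assumption)+

lemma sw_mult [pull]:
  assumes "x \<in> carrier A" "y \<in> carrier A"
    "is_vspace U" "\<And>y. y \<in> carrier A \<Longrightarrow> lin A U (\<lambda>x. F x y)" "\<And>x. x \<in> carrier A \<Longrightarrow> lin A U (\<lambda>y. F x y)"
  shows "sw A U (mult A x y) F = sw A U x (\<lambda>x1 x2. sw A U y (\<lambda>y1 y2. F (mult A x1 y1) (mult A x2 y2)))"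
proof -
  let ?T = "tensor_space A A"
  have B: "bilin A A U F" using assms by (simp add: bilin_def)
  have "comult A (mult A x y) = sweedler A x (\<lambda>x1 x2. sweedler A y (\<lambda>y1 y2. tens A A (mult A x1 y1) (mult A x2 y2)))"
    using hopf assms by (simp add: hopf_algebra_def)
  then have eq: "comult A (mult A x y) = sw A ?T x (\<lambda>x1 x2. sw A ?T y (\<lambda>y1 y2. tens A A (mult A x1 y1) (mult A x2 y2)))"
    using assms by (simp add: sw_eq[where U = ?T])
  show ?thesis
    using assms(1,2)
    by (subst sw_eqI[OF coalg _ assms(3) eq _ assms(4,5)])
      (simp_all add: tlift_sw[OF vs vs assms(3) B] tlift_tens[OF vs vs assms(3) B])
qed

text \<open>Both sides are convolution inverses of the multiplication on A \<otimes> A. In S(x1 y1)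
  x2 y2 S(y3) S(x3) either the last four or the first three factors cancel.\<close>

lemma antipode_mult [simp]:
  assumes [simp]: "x \<in> carrier A" "y \<in> carrier A"
  shows "antipode A (mult A x y) = mult A (antipode A y) (antipode A x)"
proof -
  let ?S = "antipode A" let ?m = "mult A"
  let ?T1 = "sw A A x (\<lambda>x1 r. sw A A y (\<lambda>y1 s. ?m (?S (?m x1 y1))
    (sw A A r (\<lambda>x2 x3. ?m (?m x2 (sw A A s (\<lambda>y2 y3. ?m y2 (?S y3)))) (?S x3)))))"
  let ?T2 = "sw A A x (\<lambda>p x3. sw A A y (\<lambda>q y3. ?m (sw A A (?m p q) (\<lambda>u v. ?m (?S u) v))
    (?m (?S y3) (?S x3))))"
  have "?T1 = ?S (?m x y)"
    by (simp add: eval)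
  moreover have "?T2 = ?m (?S y) (?S x)"
    by (simp add: eval)
  moreover have "?T1 = ?T2"
    by (simp add: pull)
  ultimately show ?thesis by simp
qed

lemma antipode_one [simp]: "antipode A (one A) = one A"
  using antipode_l[of "one A"] by simp

lemma antipode_counit [simp]:
  assumes [simp]: "x \<in> carrier A"
  shows "counit A (antipode A x) = counit A x"
proof -
  have "counit A x = counit A (sw A A x (\<lambda>x1 x2. mult A (antipode A x1) x2))"
    by (simp add: eval del: eps_simps)
  also have "\<dots> = sw A ground x (\<lambda>x1 x2. scale ground (counit A x2) (counit A (antipode A x1)))"
    by (simp add: ground_scale mult.commute)
  also have "\<dots> = counit A (antipode A x)"
    by simp
  finally show ?thesis by simp
qed

text \<open>The maps x \<mapsto> \<Delta>(S(x)) and x \<mapsto> S(x2) \<otimes> S(x1) are both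
  convolution inverses of \<Delta>. The comparison runs through \<Delta>(S(x1)) (x2 S(x5) \<otimes>
  x3 S(x4)).\<close>

lemma sw_antipode [pull]:
  assumes [simp]: "x \<in> carrier A" "is_vspace U"
    and F: "\<And>y. y \<in> carrier A \<Longrightarrow> lin A U (\<lambda>x. F x y)" "\<And>x. x \<in> carrier A \<Longrightarrow> lin A U (\<lambda>y. F x y)"
  shows "sw A U (antipode A x) F = sw A U x (\<lambda>x1 x2. F (antipode A x2) (antipode A x1))"
proof -
  let ?S = "antipode A" let ?m = "mult A" let ?T = "tensor_space A A"
  let ?R = "sw A ?T x (\<lambda>x1 r. sw A ?T (?S x1) (\<lambda>u v.
      tens A A (?m u (sw A A r (\<lambda>x2 s. ?m x2 (?S s)))) v))"
  let ?T1 = "sw A ?T x (\<lambda>x1 r. sw A ?T r (\<lambda>x2 s. sw A ?T s (\<lambda>p x5. sw A ?T (?S x1) (\<lambda>u v.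
      tens A A (?m u (?m x2 (?S x5))) (?m v (sw A A p (\<lambda>x3 x4. ?m x3 (?S x4))))))))"
  let ?T2 = "sw A ?T x (\<lambda>q r. sw A ?T r (\<lambda>x4 x5. sw A ?T (sw A A q (\<lambda>x1 p. ?m (?S x1) p))
      (\<lambda>u v. tens A A (?m u (?S x5)) (?m v (?S x4)))))"
  have "comult A (?S x) = sw A ?T (?S x) (tens A A)" by (simp add: comult_sw)
  also have "\<dots> = ?R" by (simp add: eval)
  also have "\<dots> = sw A ?T x (\<lambda>x1 r. sw A ?T r (\<lambda>x2 s. sw A ?T (?S x1) (\<lambda>u v.
      tens A A (?m u (?m x2 (?S s))) v)))" by (simp add: pull)
  also have "\<dots> = ?T1" by (simp add: eval)
  \<comment> \<open>The parts of S(x1) and the adjacent parts of x form the coproduct of a single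
    product S(x1) x2, which evaluates to a counit.\<close>
  also have "\<dots> = ?T2" by (simp add: pull)
  also have "\<dots> = sw A ?T x (\<lambda>x1 x2. tens A A (?S x2) (?S x1))" by (simp add: eval)
  finally have eq: "comult A (?S x) = sw A ?T x (\<lambda>x1 x2. tens A A (?S x2) (?S x1))" .
  have B: "bilin A A U F" using F by (simp add: bilin_def)
  show ?thesis
    by (subst sw_eqI[OF coalg _ assms(2) eq _ F]) (simp_all add: tlift_tens[OF vs vs assms(2) B])
qed

end


section \<open>Matched pairs with a projection\<close>

locale hopf_matched_pair =
  H: hopf_alg H + K: hopf_alg K
  for H :: "('k::field, 'h::ab_group_add) hopf" and K :: "('k, 'l::ab_group_add) hopf" +
  fixes la :: "'h \<Rightarrow> 'l \<Rightarrow> 'l" and ra :: "'h \<Rightarrow> 'l \<Rightarrow> 'h"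
  assumes mp: "matched_pair H K la ra"
begin

text \<open>The normal form has the sums over \<open>K\<close> outside those over \<open>H\<close>;
  the rules for the two actions are stated in that order.\<close>

lemma K_first [pull]:
  "sw H U x (\<lambda>x1 x2. sw K U' a (\<lambda>a1 a2. F x1 x2 a1 a2)) =
   sw K U' a (\<lambda>a1 a2. sw H U x (\<lambda>x1 x2. F x1 x2 a1 a2))"
  by (rule sw_swap)

lemma la_bilin: "bilin H K K la" and ra_bilin: "bilin H K H ra"
  using mp by (auto simp: matched_pair_def left_module_def right_module_def)

lemmas la_simps [simp] = bilin_app[OF H.vs K.vs la_bilin]
lemmas ra_simps [simp] = bilin_app[OF H.vs K.vs ra_bilin]

lemma la_mult [simp]: "x \<in> carrier H \<Longrightarrow> y \<in> carrier H \<Longrightarrow> a \<in> carrier K \<Longrightarrow>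
    la (mult H x y) a = la x (la y a)"
  and la_one [simp]: "a \<in> carrier K \<Longrightarrow> la (one H) a = a"
  and la_counit [simp]: "x \<in> carrier H \<Longrightarrow> a \<in> carrier K \<Longrightarrow> counit K (la x a) = counit H x * counit K a"
  and ra_counit [simp]: "x \<in> carrier H \<Longrightarrow> a \<in> carrier K \<Longrightarrow> counit H (ra x a) = counit H x * counit K a"
  and la_unit [simp]: "x \<in> carrier H \<Longrightarrow> la x (one K) = scale K (counit H x) (one K)"
  and ra_unit [simp]: "a \<in> carrier K \<Longrightarrow> ra (one H) a = scale H (counit K a) (one H)"
  using mp by (auto simp: matched_pair_def left_module_def bilinear_coalgebra_map_def)

lemma sw_la [pull]:
  assumes "x \<in> carrier H" "a \<in> carrier K" "is_vspace U"
    and F: "\<And>y. y \<in> carrier K \<Longrightarrow> lin K U (\<lambda>x. F x y)" "\<And>x. x \<in> carrier K \<Longrightarrow> lin K U (\<lambda>y. F x y)"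
  shows "sw K U (la x a) F = sw K U a (\<lambda>a1 a2. sw H U x (\<lambda>x1 x2. F (la x1 a1) (la x2 a2)))"
proof -
  let ?T = "tensor_space K K"
  have "comult K (la x a) = sweedler H x (\<lambda>x1 x2. sweedler K a (\<lambda>a1 a2. tens K K (la x1 a1) (la x2 a2)))"
    using mp assms(1,2) by (simp add: matched_pair_def bilinear_coalgebra_map_def)
  then have eq: "comult K (la x a) = sw K ?T a (\<lambda>a1 a2. sw H ?T x (\<lambda>x1 x2. tens K K (la x1 a1) (la x2 a2)))"
    using assms(1,2) by (simp add: H.sw_eq[where U = ?T] K.sw_eq[where U = ?T] K_first)
  have B: "bilin K K U F" using F by (simp add: bilin_def)
  show ?thesis using assms(1,2)
    by (subst sw_eqI[OF K.coalg _ assms(3) eq _ F])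
      (simp_all add: tlift_sw[OF K.vs K.vs assms(3) B] tlift_tens[OF K.vs K.vs assms(3) B])
qed

lemma sw_ra [pull]:
  assumes "x \<in> carrier H" "a \<in> carrier K" "is_vspace U"
    and F: "\<And>y. y \<in> carrier H \<Longrightarrow> lin H U (\<lambda>x. F x y)" "\<And>x. x \<in> carrier H \<Longrightarrow> lin H U (\<lambda>y. F x y)"
  shows "sw H U (ra x a) F = sw K U a (\<lambda>a1 a2. sw H U x (\<lambda>x1 x2. F (ra x1 a1) (ra x2 a2)))"
proof -
  let ?T = "tensor_space H H"
  have "comult H (ra x a) = sweedler H x (\<lambda>x1 x2. sweedler K a (\<lambda>a1 a2. tens H H (ra x1 a1) (ra x2 a2)))"
    using mp assms(1,2) by (simp add: matched_pair_def bilinear_coalgebra_map_def)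
  then have eq: "comult H (ra x a) = sw K ?T a (\<lambda>a1 a2. sw H ?T x (\<lambda>x1 x2. tens H H (ra x1 a1) (ra x2 a2)))"
    using assms(1,2) by (simp add: H.sw_eq[where U = ?T] K.sw_eq[where U = ?T] K_first)
  have B: "bilin H H U F" using F by (simp add: bilin_def)
  show ?thesis using assms(1,2)
    by (subst sw_eqI[OF H.coalg _ assms(3) eq _ F])
      (simp_all add: tlift_sw[OF H.vs H.vs assms(3) B] tlift_tens[OF H.vs H.vs assms(3) B])
qed

lemma la_prod:
  assumes "x \<in> carrier H" "a \<in> carrier K" "b \<in> carrier K"
  shows "la x (mult K a b) =
    sw K K a (\<lambda>a1 a2. sw H K x (\<lambda>x1 x2. mult K (la x1 a1) (la (ra x2 a2) b)))"
proof -
  have "la x (mult K a b) =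
      sweedler H x (\<lambda>x1 x2. sweedler K a (\<lambda>a1 a2. mult K (la x1 a1) (la (ra x2 a2) b)))"
    using mp assms by (simp add: matched_pair_def)
  then show ?thesis
    using assms by (simp add: H.sw_eq[where U = K] K.sw_eq[where U = K] K_first)
qed

text \<open>The compatibility of the two actions, tested against a bilinear \<open>F\<close>. Both
  sides have the same shape, so as a rewrite rule it could loop; it is applied by hand in
  \<open>rho_la\<close>.\<close>

lemma la_ra_swap:
  assumes "x \<in> carrier H" "a \<in> carrier K" "is_vspace U"
    and F: "\<And>y. y \<in> carrier H \<Longrightarrow> lin K U (\<lambda>x. F x y)" "\<And>x. x \<in> carrier K \<Longrightarrow> lin H U (\<lambda>y. F x y)"
  shows "sw K U a (\<lambda>a1 a2. sw H U x (\<lambda>x1 x2. F (la x1 a1) (ra x2 a2))) =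
    sw K U a (\<lambda>a1 a2. sw H U x (\<lambda>x1 x2. F (la x2 a2) (ra x1 a1)))"
proof -
  let ?T = "tensor_space K H"
  have B: "bilin K H U F" using F by (simp add: bilin_def)
  have "sweedler H x (\<lambda>x1 x2. sweedler K a (\<lambda>a1 a2. tens K H (la x1 a1) (ra x2 a2))) =
        sweedler H x (\<lambda>x1 x2. sweedler K a (\<lambda>a1 a2. tens K H (la x2 a2) (ra x1 a1)))"
    using mp assms by (simp add: matched_pair_def)
  then have "sw K ?T a (\<lambda>a1 a2. sw H ?T x (\<lambda>x1 x2. tens K H (la x1 a1) (ra x2 a2))) =
        sw K ?T a (\<lambda>a1 a2. sw H ?T x (\<lambda>x1 x2. tens K H (la x2 a2) (ra x1 a1)))"
    using assms(1,2) by (simp add: H.sw_eq[where U = ?T] K.sw_eq[where U = ?T] K_first)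
  from arg_cong[OF this, of "tlift K H F"] show ?thesis using assms(1,2)
    by (simp add: tlift_sw[OF K.vs H.vs assms(3) B] tlift_tens[OF K.vs H.vs assms(3) B])
qed

end

text \<open>Of the projection \<theta> only its consequences for \<pi> are kept: \<pi> is a
  bialgebra map, and \<open>star\<close> is \<theta> applied to the product of 1 \<otimes> x and b
  \<otimes> 1. They are supplied by \<open>matched_projection_of_hom\<close>.\<close>

locale matched_projection = hopf_matched_pair H K la ra
  for H :: "('k::field, 'h::ab_group_add) hopf" and K :: "('k, 'l::ab_group_add) hopf"
    and la :: "'h \<Rightarrow> 'l \<Rightarrow> 'l" and ra :: "'h \<Rightarrow> 'l \<Rightarrow> 'h" +
  fixes \<pi> :: "'l \<Rightarrow> 'h"
  assumes pi_coalg: "coalgebra_hom K H \<pi>"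
    and pi_one [simp]: "\<pi> (one K) = one H"
    and pi_mult [simp]: "\<And>a b. a \<in> carrier K \<Longrightarrow> b \<in> carrier K \<Longrightarrow> \<pi> (mult K a b) = mult H (\<pi> a) (\<pi> b)"
    and star: "\<And>x b. x \<in> carrier H \<Longrightarrow> b \<in> carrier K \<Longrightarrow>
      mult H x (\<pi> b) = sw K H b (\<lambda>b1 b2. sw H H x (\<lambda>x1 x2. mult H (\<pi> (la x1 b1)) (ra x2 b2)))"
begin

lemma pi_lin: "lin K H \<pi>"
  using pi_coalg by (simp add: coalgebra_hom_def)

lemmas pi_simps [simp] = lin_app[OF K.vs pi_lin]

lemma pi_counit [simp]: "a \<in> carrier K \<Longrightarrow> counit H (\<pi> a) = counit K a"
  using pi_coalg by (simp add: coalgebra_hom_def)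

lemma sw_pi [pull]:
  assumes "a \<in> carrier K" "is_vspace U"
    and F: "\<And>y. y \<in> carrier H \<Longrightarrow> lin H U (\<lambda>x. F x y)" "\<And>x. x \<in> carrier H \<Longrightarrow> lin H U (\<lambda>y. F x y)"
  shows "sw H U (\<pi> a) F = sw K U a (\<lambda>a1 a2. F (\<pi> a1) (\<pi> a2))"
proof -
  let ?T = "tensor_space H H"
  have eq: "comult H (\<pi> a) = sw K ?T a (\<lambda>a1 a2. tens H H (\<pi> a1) (\<pi> a2))"
    using pi_coalg assms(1) by (simp add: coalgebra_hom_def K.sw_eq[where U = ?T])
  have B: "bilin H H U F" using F by (simp add: bilin_def)
  show ?thesis using assms(1)
    by (subst sw_eqI[OF H.coalg _ assms(2) eq _ F]) (simp_all add: tlift_tens[OF H.vs H.vs assms(2) B])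
qed

text \<open>In S(\<pi>(a1)) \<pi>(a2) \<pi>(S(a3)) either adjacent pair cancels: both sides are
  convolution inverses of \<pi>.\<close>

lemma pi_antipode [simp]:
  assumes [simp]: "a \<in> carrier K"
  shows "\<pi> (antipode K a) = antipode H (\<pi> a)"
proof -
  let ?T1 = "sw K H a (\<lambda>a1 r. mult H (antipode H (\<pi> a1))
    (\<pi> (sw K K r (\<lambda>a2 a3. mult K a2 (antipode K a3)))))"
  let ?T2 = "sw K H a (\<lambda>p a3. mult H (sw H H (\<pi> p) (\<lambda>u v. mult H (antipode H u) v))
    (\<pi> (antipode K a3)))"
  have "?T1 = antipode H (\<pi> a)" by (simp add: eval)
  moreover have "?T2 = \<pi> (antipode K a)" by (simp add: eval)
  moreover have "?T1 = ?T2" by (simp add: pull)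
  ultimately show ?thesis by simp
qed

lemma antipode_pi_l [eval]: "a \<in> carrier K \<Longrightarrow>
    sw K H a (\<lambda>a1 a2. mult H (antipode H (\<pi> a1)) (\<pi> a2)) = scale H (counit K a) (one H)"
  and antipode_pi_r [eval]: "a \<in> carrier K \<Longrightarrow>
    sw K H a (\<lambda>a1 a2. mult H (\<pi> a1) (antipode H (\<pi> a2))) = scale H (counit K a) (one H)"
  using H.antipode_l[of "\<pi> a"] H.antipode_r[of "\<pi> a"] by (simp_all add: sw_pi)

text \<open>Multiply \<open>star\<close> by S(\<pi>(x1 \<rightharpoonup> a1)) from the left and by
  S(\<pi>(a3)) from the right. One side collapses through \<pi>(a2) S(\<pi>(a3)), the other through
  S(\<pi>(x1 \<rightharpoonup> a1)) \<pi>(x2 \<rightharpoonup> a2).\<close>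

lemma ra_antipode:
  assumes [simp]: "x \<in> carrier H" "a \<in> carrier K"
  shows "sw K H a (\<lambda>a1 a2. mult H (ra x a1) (antipode H (\<pi> a2))) =
    sw H H x (\<lambda>x1 x2. mult H (antipode H (\<pi> (la x1 a))) x2)"
proof -
  let ?S = "antipode H" let ?m = "mult H"
  let ?T1 = "sw K H a (\<lambda>a1 s. sw H H x (\<lambda>x1 r. ?m (?S (\<pi> (la x1 a1)))
    (?m r (sw K H s (\<lambda>a2 a3. ?m (\<pi> a2) (?S (\<pi> a3)))))))"
  let ?star = "\<lambda>x b. sw K H b (\<lambda>b1 b2. sw H H x (\<lambda>x1 x2. ?m (\<pi> (la x1 b1)) (ra x2 b2)))"
  let ?T2 = "sw K H a (\<lambda>p a3. sw K H p (\<lambda>a1 q. sw H H x (\<lambda>x1 r. ?m (?S (\<pi> (la x1 a1)))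
    (?m (?star r q) (?S (\<pi> a3))))))"
  let ?T3 = "sw K H a (\<lambda>q r. sw K H r (\<lambda>a3 a4. sw H H x (\<lambda>y x3.
    ?m (sw K H (la y q) (\<lambda>u v. ?m (?S (\<pi> u)) (\<pi> v))) (?m (ra x3 a3) (?S (\<pi> a4))))))"
  have "?T1 = sw H H x (\<lambda>x1 x2. mult H (antipode H (\<pi> (la x1 a))) x2)"
    by (simp add: eval)
  moreover have "?T3 = sw K H a (\<lambda>a1 a2. mult H (ra x a1) (antipode H (\<pi> a2)))"
    by (simp add: eval)
  \<comment> \<open>Read backwards: the copy \<open>?star\<close> of the right side of
    \<open>star\<close> is folded to a product.\<close>
  moreover have "?T1 = ?T2"
    by (simp add: star[symmetric] pull)
  moreover have "?T2 = ?T3"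
    by (simp add: pull)
  ultimately show ?thesis by simp
qed

text \<open>The product of K_\<pi> with \<pi>(S(a2)) replaced by the equal S(\<pi>(a2)), which the
  evaluation rules for the antipode of \<open>H\<close> recognise.\<close>

definition bullet where "bullet a = (\<lambda>b. sw K K a (\<lambda>a1 a2. mult K a1 (la (antipode H (\<pi> a2)) b)))"

lemma bullet_bilin: "bilin K K K bullet"
  by (rule bilinI) (simp_all add: bullet_def)

lemmas bullet_simps [simp] = bilin_app[OF K.vs K.vs bullet_bilin]

text \<open>Acting on a1 (S(\<pi>(a2)) \<rightharpoonup> b) produces (x2 \<leftharpoonup> a2)
  S(\<pi>(a3)) in front of b. By \<open>ra_antipode\<close> this becomes S(\<pi>(x2
  \<rightharpoonup> a2)) x3, the factor required by the product of x1 \<rightharpoonup> a and x2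
  \<rightharpoonup> b.\<close>

lemma la_bullet:
  assumes [simp]: "x \<in> carrier H" "a \<in> carrier K" "b \<in> carrier K"
  shows "la x (bullet a b) = sw H K x (\<lambda>x1 x2. bullet (la x1 a) (la x2 b))"
proof -
  let ?T = "sw K K a (\<lambda>a1 q. sw H K x (\<lambda>x1 x2. mult K (la x1 a1)
    (la (sw K H q (\<lambda>a2 a3. mult H (ra x2 a2) (antipode H (\<pi> a3)))) b)))"
  have "la x (bullet a b) = ?T"
    by (simp add: pull bullet_def la_prod)
  also have "?T = sw K K a (\<lambda>a1 q. sw H K x (\<lambda>x1 x2. mult K (la x1 a1)
    (la (sw H H x2 (\<lambda>x2 x3. mult H (antipode H (\<pi> (la x2 q))) x3)) b)))"
    by (simp only: ra_antipode cong: sw_cong)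
  also have "\<dots> = sw H K x (\<lambda>x1 x2. bullet (la x1 a) (la x2 b))"
    by (simp add: pull bullet_def)
  finally show ?thesis .
qed

text \<open>The factor S(\<pi>(a2)) \<pi>(a3) acting on b cancels, which undoes the deformation of
  the product.\<close>

lemma mult_bullet:
  assumes [simp]: "a \<in> carrier K" "b \<in> carrier K"
  shows "sw K K a (\<lambda>a1 a2. bullet a1 (la (\<pi> a2) b)) = mult K a b"
proof -
  let ?T = "sw K K a (\<lambda>a1 q. mult K a1 (la (sw K H q (\<lambda>a2 a3. mult H (antipode H (\<pi> a2)) (\<pi> a3))) b))"
  have "?T = mult K a b" by (simp add: eval)
  moreover have "?T = sw K K a (\<lambda>a1 a2. bullet a1 (la (\<pi> a2) b))" by (simp add: bullet_def pull)
  ultimately show ?thesis by simp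
qed

lemma bullet_one [simp]: "a \<in> carrier K \<Longrightarrow> bullet (one K) a = a" "a \<in> carrier K \<Longrightarrow> bullet a (one K) = a"
  by (simp_all add: bullet_def)

text \<open>Associativity with b replaced by \<pi>(a2) \<rightharpoonup> b, the form in which
  \<open>mult_bullet\<close> turns the inner product into that of \<open>K\<close>.\<close>

lemma bullet_assoc_aux:
  assumes [simp]: "a \<in> carrier K" "b \<in> carrier K" "c \<in> carrier K"
  shows "sw K K a (\<lambda>a1 q. bullet (bullet a1 (la (\<pi> q) b)) c) = sw K K a (\<lambda>a1 q. bullet a1 (bullet (la (\<pi> q) b) c))"
proof -
  let ?S = "antipode H" let ?m = "mult H"
  have "sw K K a (\<lambda>a1 q. bullet (bullet a1 (la (\<pi> q) b)) c) = bullet (sw K K a (\<lambda>a1 q. bullet a1 (la (\<pi> q) b))) c"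
    by simp
  also have "\<dots> = bullet (mult K a b) c" by (simp add: mult_bullet)
  \<comment> \<open>Associativity in \<open>K\<close>, together with S(\<pi>(a2) \<pi>(b2)) =
    S(\<pi>(b2)) S(\<pi>(a2)).\<close>
  also have "\<dots> = sw K K a (\<lambda>a1 a2. mult K a1 (bullet b (la (?S (\<pi> a2)) c)))"
    by (simp add: bullet_def pull)
  \<comment> \<open>\<open>mult_bullet\<close> again, now to return from the product of
    \<open>K\<close> to \<open>bullet\<close>.\<close>
  also have "\<dots> = sw K K a (\<lambda>a1 a2. sw K K a1 (\<lambda>a1 q. bullet a1 (la (\<pi> q) (bullet b (la (?S (\<pi> a2)) c)))))"
    by (simp add: mult_bullet)
  \<comment> \<open>\<open>la_bullet\<close> distributes the action of \<pi> over the product; the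
    part that reaches c meets an S(\<pi>) and will cancel.\<close>
  also have "\<dots> = sw K K a (\<lambda>a1 q. bullet a1 (sw K K q (\<lambda>u v. bullet (la (\<pi> u) b)
      (la (sw K H v (\<lambda>v w. ?m (\<pi> v) (?S (\<pi> w)))) c))))"
    by (simp add: pull la_bullet)
  also have "\<dots> = sw K K a (\<lambda>a1 q. bullet a1 (bullet (la (\<pi> q) b) c))"
    by (simp add: eval)
  finally show ?thesis .
qed

text \<open>Writing b as \<pi>(a2) S(\<pi>(a3)) \<rightharpoonup> b, with a1 left in front, brings
  an arbitrary b into the form of \<open>bullet_assoc_aux\<close>.\<close>

lemma bullet_assoc [simp]:
  assumes [simp]: "a \<in> carrier K" "b \<in> carrier K" "c \<in> carrier K"
  shows "bullet (bullet a b) c = bullet a (bullet b c)"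
proof -
  let ?S = "antipode H" let ?m = "mult H"
  let ?e = "\<lambda>q. la (sw K H q (\<lambda>v w. ?m (\<pi> v) (?S (\<pi> w)))) b"
  have "bullet (bullet a b) c = sw K K a (\<lambda>a1 q. bullet (bullet a1 (?e q)) c)" by (simp add: eval)
  also have "\<dots> = sw K K a (\<lambda>a1 a2. sw K K a1 (\<lambda>a1 q. bullet (bullet a1 (la (\<pi> q) (la (?S (\<pi> a2)) b))) c))"
    by (simp add: pull)
  also have "\<dots> = sw K K a (\<lambda>a1 a2. sw K K a1 (\<lambda>a1 q. bullet a1 (bullet (la (\<pi> q) (la (?S (\<pi> a2)) b)) c)))"
    by (simp add: bullet_assoc_aux)
  also have "\<dots> = sw K K a (\<lambda>a1 q. bullet a1 (bullet (?e q) c))" by (simp add: pull)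
  also have "\<dots> = bullet a (bullet b c)" by (simp add: eval)
  finally show ?thesis .
qed

end


section \<open>The coaction\<close>

context matched_projection begin

text \<open>\<open>coact_sw U a F\<close> is \<open>F a\<^sub>-\<^sub>1 a\<^sub>0\<close> with respect to the coaction \<open>\<rho>\<close> below.\<close>

abbreviation coact_sw where
  "coact_sw U a F \<equiv> sw K U a (\<lambda>a1 r. sw K U r (\<lambda>a2 a3. F (mult H (\<pi> a1) (antipode H (\<pi> a3))) a2))"

abbreviation "HK \<equiv> tensor_space H K"
abbreviation "KK \<equiv> tensor_space K K"

text \<open>Common form on the carrier of \<open>Coad\<close> and of the coaction a \<mapsto>
  \<pi>(a1 S(a3)) \<otimes> a2.\<close>

definition \<rho> where "\<rho> a = coact_sw (HK) a (tens H K)"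

lemma rho_lin: "lin K (HK) \<rho>"
  by (subst lin_cong[OF K.vs \<rho>_def]) simp

lemmas rho_simps [simp] = lin_app[OF K.vs rho_lin]

lemma tlift_rho:
  assumes "is_vspace U" "a \<in> carrier K"
    and F: "\<And>y. y \<in> carrier K \<Longrightarrow> lin H U (\<lambda>x. F x y)" "\<And>x. x \<in> carrier H \<Longrightarrow> lin K U (\<lambda>y. F x y)"
  shows "tlift H K F (\<rho> a) = coact_sw U a F"
proof -
  have B: "bilin H K U F" using F by (simp add: bilin_def)
  show ?thesis
    by (simp add: \<rho>_def tlift_sw[OF H.vs K.vs assms(1) B] tlift_tens[OF H.vs K.vs assms(1) B])
qed

text \<open>Both sides are \<pi>(a1) S(\<pi>(a5)) \<otimes> \<pi>(a2) S(\<pi>(a4)) \<otimes> a3,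
  because \<pi> preserves coproducts and S reverses them.\<close>

lemma rho_coassoc:
  assumes [simp]: "a \<in> carrier K"
  shows "coact_sw (tensor_space H HK) a (\<lambda>x m. sw H (tensor_space H HK) x (\<lambda>x1 x2. tens H (HK) x1 (tens H K x2 m))) =
    coact_sw (tensor_space H HK) a (\<lambda>x m. tens H (HK) x (\<rho> m))"
  by (simp add: \<rho>_def pull)

text \<open>The Yetter-Drinfeld condition. Its right side contains x1 \<pi>(m1) and S(x3 \<pi>(m3));
  \<open>star\<close> splits off a factor with \<leftharpoonup> from each. After
  \<open>la_ra_swap\<close> has been used once on either side of x2 \<rightharpoonup> m2, these two
  factors are neighbours of the form u S(v) and cancel.\<close>

lemma rho_la:
  assumes [simp]: "x \<in> carrier H" "m \<in> carrier K"
  shows "\<rho> (la x m) = sw H HK x (\<lambda>x1 r. sw H HK r (\<lambda>x2 x3. coact_sw HK m (\<lambda>y n.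
    tens H K (mult H (mult H x1 y) (antipode H x3)) (la x2 n))))" (is "_ = ?R")
proof -
  let ?S = "antipode H" let ?m = "mult H"
  let ?star = "\<lambda>x b. sw K H b (\<lambda>b1 b2. sw H H x (\<lambda>x1 x2. ?m (\<pi> (la x1 b1)) (ra x2 b2)))"
  let ?A = "sw K HK m (\<lambda>m1 r. sw K HK r (\<lambda>m2 m3. sw H HK x (\<lambda>x1 r. sw H HK r (\<lambda>x2 x3.
    tens H K (?m (?star x1 m1) (?S (?star x3 m3))) (la x2 m2)))))"
  let ?E = "\<lambda>m1 q p x1 y z. sw K HK q (\<lambda>q1 q2. sw H HK y (\<lambda>y1 y2.
      sw K HK p (\<lambda>p1 p2. sw H HK z (\<lambda>z1 z2.
      tens H K (?m (\<pi> (la x1 m1)) (?m (ra y1 q1) (?m (?S (ra z2 p2)) (?S (\<pi> (la z1 p1)))))) (la y2 q2)))))"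
  let ?E' = "\<lambda>m1 q p x1 y z. sw K HK q (\<lambda>q1 q2. sw H HK y (\<lambda>y1 y2.
      sw K HK p (\<lambda>p1 p2. sw H HK z (\<lambda>z1 z2.
      tens H K (?m (\<pi> (la x1 m1)) (?m (ra y2 q2) (?m (?S (ra z1 p1)) (?S (\<pi> (la z2 p2)))))) (la y1 q1)))))"
  let ?B = "\<lambda>E. sw K HK m (\<lambda>m1 r. sw K HK r (\<lambda>q p. sw H HK x (\<lambda>x1 r. sw H HK r (\<lambda>y z. E m1 q p x1 y z))))"
  let ?C = "sw K HK m (\<lambda>m1 r. sw K HK r (\<lambda>m2 s. sw K HK s (\<lambda>b m5.
    sw H HK x (\<lambda>x1 r. sw H HK r (\<lambda>x2 s. sw H HK s (\<lambda>z x5.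
    tens H K (?m (\<pi> (la x1 m1)) (?m (sw H H (ra z b) (\<lambda>u v. ?m u (?S v))) (?S (\<pi> (la x5 m5))))) (la x2 m2)))))))"
  have "?R = ?A"
    by (simp add: star[symmetric] pull)
  also have "?A = ?B ?E"
    by (simp add: pull)
  also have "\<dots> = ?B ?E'"
  proof (rule sw_cong[OF refl], rule sw_cong[OF refl], rule sw_cong[OF refl], rule sw_cong[OF refl])
    fix m1 r q p x1 r' y z
    assume [simp]: "m1 \<in> carrier K" "q \<in> carrier K" "p \<in> carrier K"
      "x1 \<in> carrier H" "y \<in> carrier H" "z \<in> carrier H"
    \<comment> \<open>The first exchange gives the second leg the earlier parts of \<open>y\<close>
      and \<open>q\<close>; the second one, further down, reverses the pair under the
      antipodes.\<close>
    have "?E m1 q p x1 y z = sw K HK q (\<lambda>q1 q2. sw H HK y (\<lambda>y1 y2.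
      sw K HK p (\<lambda>p1 p2. sw H HK z (\<lambda>z1 z2.
      tens H K (?m (\<pi> (la x1 m1)) (?m (ra y2 q2) (?m (?S (ra z2 p2)) (?S (\<pi> (la z1 p1)))))) (la y1 q1)))))"
      by (rule la_ra_swap[of y q HK "\<lambda>k h. sw K HK p (\<lambda>p1 p2. sw H HK z (\<lambda>z1 z2.
        tens H K (?m (\<pi> (la x1 m1)) (?m h (?m (?S (ra z2 p2)) (?S (\<pi> (la z1 p1)))))) k))", symmetric])
        simp_all
    also have "\<dots> = ?E' m1 q p x1 y z"
    proof (rule sw_cong[OF refl], rule sw_cong[OF refl])
      fix q1 q2 y1 y2
      assume [simp]: "q1 \<in> carrier K" "q2 \<in> carrier K" "y1 \<in> carrier H" "y2 \<in> carrier H"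
      show "sw K HK p (\<lambda>p1 p2. sw H HK z (\<lambda>z1 z2.
        tens H K (?m (\<pi> (la x1 m1)) (?m (ra y2 q2) (?m (?S (ra z2 p2)) (?S (\<pi> (la z1 p1)))))) (la y1 q1))) =
        sw K HK p (\<lambda>p1 p2. sw H HK z (\<lambda>z1 z2.
        tens H K (?m (\<pi> (la x1 m1)) (?m (ra y2 q2) (?m (?S (ra z1 p1)) (?S (\<pi> (la z2 p2)))))) (la y1 q1)))"
      by (rule la_ra_swap[of z p HK "\<lambda>k h.
        tens H K (?m (\<pi> (la x1 m1)) (?m (ra y2 q2) (?m (?S h) (?S (\<pi> k))))) (la y1 q1)"])
        simp_all
    qed
    finally show "?E m1 q p x1 y z = ?E' m1 q p x1 y z" .
  qed
  also have "\<dots> = ?C"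
    by (simp add: pull)
  \<comment> \<open>Without \<open>sw_ra\<close> the coproduct of \<open>ra z b\<close> stays intact
    until the antipode axiom evaluates it.\<close>
  also have "\<dots> = \<rho> (la x m)"
    by (simp add: pull eval \<rho>_def del: sw_ra)
  finally show ?thesis by simp
qed

text \<open>\<open>rho_la\<close> tested against an arbitrary bilinear \<open>F\<close>, as needed
  when the coaction of x \<rightharpoonup> m occurs inside a larger expression.\<close>

lemma coact_sw_la:
  assumes [simp]: "is_vspace U" "x \<in> carrier H" "m \<in> carrier K"
    and F [simp]: "\<And>y. y \<in> carrier K \<Longrightarrow> lin H U (\<lambda>x. F x y)" "\<And>x. x \<in> carrier H \<Longrightarrow> lin K U (\<lambda>y. F x y)"
  shows "coact_sw U (la x m) F = sw H U x (\<lambda>x1 r. sw H U r (\<lambda>x2 x3. coact_sw U m (\<lambda>y n.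
    F (mult H (mult H x1 y) (antipode H x3)) (la x2 n))))"
proof -
  have B: "bilin H K U F" using F by (simp add: bilin_def)
  have "coact_sw U (la x m) F = tlift H K F (\<rho> (la x m))"
    by (rule tlift_rho[symmetric]) simp_all
  also have "\<dots> = sw H U x (\<lambda>x1 r. sw H U r (\<lambda>x2 x3. coact_sw U m (\<lambda>y n.
    F (mult H (mult H x1 y) (antipode H x3)) (la x2 n))))"
    by (simp add: rho_la tlift_sw[OF H.vs K.vs assms(1) B] tlift_tens[OF H.vs K.vs assms(1) B])
  finally show ?thesis .
qed

end


section \<open>The product and the antipode\<close>

context matched_projection begin

text \<open>The coaction of S(\<pi>(a)) \<rightharpoonup> b contributes a double antipode, which is
  absorbed by S(S(\<pi>(a4))) S(\<pi>(a3)) = S(\<pi>(a3) S(\<pi>(a4))), a counit.\<close>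

lemma rho_bullet:
  assumes [simp]: "a \<in> carrier K" "b \<in> carrier K"
  shows "\<rho> (bullet a b) = coact_sw HK a (\<lambda>x m. coact_sw HK b (\<lambda>y n. tens H K (mult H x y) (bullet m n)))"
proof -
  let ?S = "antipode H" let ?m = "mult H"
  let ?T1 = "sw K HK a (\<lambda>a1 r. sw K HK r (\<lambda>a2 r. sw K HK r (\<lambda>a3 w. coact_sw HK (la (?S (\<pi> w)) b)
     (\<lambda>y n. tens H K (?m (?m (\<pi> a1) y) (?S (\<pi> a3))) (mult K a2 n)))))"
  let ?T2 = "sw K HK a (\<lambda>a1 r. sw K HK r (\<lambda>a2 r. sw K HK r (\<lambda>v r. sw K HK r (\<lambda>a5 a6. coact_sw HK b
     (\<lambda>y n. tens H K (?m (\<pi> a1) (?m (?S (\<pi> a6)) (?m y (?S (sw K H v (\<lambda>v1 v2. ?m (\<pi> v1) (?S (\<pi> v2))))))))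
       (mult K a2 (la (?S (\<pi> a5)) n)))))))"
  have "\<rho> (bullet a b) = ?T1"
    by (simp add: \<rho>_def bullet_def pull)
  also have "?T1 = sw K HK a (\<lambda>a1 r. sw K HK r (\<lambda>a2 r. sw K HK r (\<lambda>a3 w.
     sw H HK (?S (\<pi> w)) (\<lambda>x1 r. sw H HK r (\<lambda>x2 x3. coact_sw HK b (\<lambda>y n.
     tens H K (?m (?m (\<pi> a1) (?m (?m x1 y) (?S x3))) (?S (\<pi> a3))) (mult K a2 (la x2 n))))))))"
    by (rule sw_cong[OF refl], rule sw_cong[OF refl], rule sw_cong[OF refl], rule coact_sw_la) simp_all
  also have "\<dots> = ?T2" by (simp add: pull)
  also have "\<dots> = coact_sw HK a (\<lambda>x m. coact_sw HK b (\<lambda>y n. tens H K (mult H x y) (bullet m n)))"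
    \<comment> \<open>Two passes: the inner sum is evaluated before \<open>pull\<close> can break it
      up.\<close>
    by (simp add: eval) (simp add: bullet_def pull)
  finally show ?thesis .
qed

text \<open>In \<pi>(a1) S(\<pi>(a3)) \<pi>(a4) S(\<pi>(a6)) \<otimes> a2 \<otimes> a5 the two
  middle factors of the first leg cancel.\<close>

lemma rho_comult:
  assumes [simp]: "a \<in> carrier K"
  shows "sw K (tensor_space H KK) a (\<lambda>a1 a2. coact_sw (tensor_space H KK) a1 (\<lambda>x m. coact_sw (tensor_space H KK) a2
      (\<lambda>y n. tens H KK (mult H x y) (tens K K m n)))) =
    coact_sw (tensor_space H KK) a (\<lambda>x m. tens H KK x (comult K m))"
proof -
  let ?S = "antipode H" let ?m = "mult H" let ?T = "tensor_space H KK"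
  let ?A = "sw K ?T a (\<lambda>a1 r. sw K ?T r (\<lambda>a2 r. sw K ?T r (\<lambda>v r. sw K ?T r (\<lambda>a5 a6.
     tens H KK (?m (\<pi> a1) (?m (sw K H v (\<lambda>v1 v2. ?m (?S (\<pi> v1)) (\<pi> v2))) (?S (\<pi> a6))))
       (tens K K a2 a5)))))"
  have "sw K ?T a (\<lambda>a1 a2. coact_sw ?T a1 (\<lambda>x m. coact_sw ?T a2
      (\<lambda>y n. tens H KK (mult H x y) (tens K K m n)))) = ?A"
    by (simp add: pull)
  also have "\<dots> = coact_sw ?T a (\<lambda>x m. tens H KK x (comult K m))"
    by (simp add: eval) (simp add: K.comult_sw pull)
  finally show ?thesis .
qed

section \<open>The antipode of K_\<pi>\<close>

definition braided_antipode where "braided_antipode = (\<lambda>a. sw K K a (\<lambda>a1 a2. la (\<pi> a1) (antipode K a2)))"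

lemma braided_antipode_lin: "lin K K braided_antipode"
  by (simp add: braided_antipode_def)

lemmas braided_antipode_simps [simp] = lin_app[OF K.vs braided_antipode_lin]

text \<open>Unfolded, S(\<pi>(a2)) \<pi>(a3) acts on the antipode of a4 and cancels; the antipode
  axiom of \<open>K\<close> remains.\<close>

lemma bullet_braided_antipode [eval]:
  assumes [simp]: "a \<in> carrier K"
  shows "sw K K a (\<lambda>a1 a2. bullet a1 (braided_antipode a2)) = scale K (counit K a) (one K)"
proof -
  let ?T = "sw K K a (\<lambda>a1 r. mult K a1 (sw K K r (\<lambda>v w.
    la (sw K H v (\<lambda>v1 v2. mult H (antipode H (\<pi> v1)) (\<pi> v2))) (antipode K w))))"
  have "sw K K a (\<lambda>a1 a2. bullet a1 (braided_antipode a2)) = ?T"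
    by (simp add: bullet_def braided_antipode_def pull)
  also have "?T = scale K (counit K a) (one K)"
    by (simp add: eval)
  finally show ?thesis .
qed

text \<open>Inserting \<pi>(a2) S(\<pi>(a3)) in front of the last factor lets
  \<open>la_bullet\<close> extract a common action of \<pi>. What it acts on has the form of
  \<open>mult_bullet\<close> for the antipode of a part of a, so the antipode axiom of
  \<open>K\<close> applies.\<close>

lemma braided_antipode_bullet [eval]:
  assumes [simp]: "a \<in> carrier K"
  shows "sw K K a (\<lambda>a1 a2. bullet (braided_antipode a1) a2) = scale K (counit K a) (one K)"
proof -
  let ?S = "antipode H" let ?m = "mult H" let ?SK = "antipode K"
  let ?A = "sw K K a (\<lambda>a1 s. sw K K s (\<lambda>v s. sw K K s (\<lambda>b c.
    bullet (la (\<pi> a1) (?SK b)) (la (sw K H v (\<lambda>v1 v2. ?m (\<pi> v1) (?S (\<pi> v2)))) c))))"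
  let ?B = "sw K K a (\<lambda>p s. la (\<pi> p) (sw K K s (\<lambda>t c. sw K K (?SK t) (\<lambda>u w. bullet u (la (\<pi> w) c)))))"
  have "sw K K a (\<lambda>a1 a2. bullet (braided_antipode a1) a2) = ?A"
    by (simp add: eval) (simp add: pull braided_antipode_def)
  also have "?A = ?B" by (simp add: pull la_bullet)
  also have "?B = sw K K a (\<lambda>p s. la (\<pi> p) (sw K K s (\<lambda>t c. mult K (?SK t) c)))"
    by (simp add: mult_bullet)
  also have "\<dots> = scale K (counit K a) (one K)" by (simp add: eval)
  finally show ?thesis .
qed

text \<open>Uniqueness of convolution inverses: both sides, as functions of x and a, are inverse to
  the action with respect to \<open>bullet\<close>.\<close>

lemma braided_antipode_la:
  assumes [simp]: "x \<in> carrier H" "a \<in> carrier K"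
  shows "braided_antipode (la x a) = la x (braided_antipode a)"
proof -
  let ?A = "sw K K a (\<lambda>a1 b. sw H K x (\<lambda>x1 y. bullet (la x1 (braided_antipode a1)) (sw K K (la y b) (\<lambda>u v. bullet u (braided_antipode v)))))"
  let ?B = "sw K K a (\<lambda>b a3. sw H K x (\<lambda>y x3. bullet (la y (sw K K b (\<lambda>b1 b2. bullet (braided_antipode b1) b2))) (braided_antipode (la x3 a3))))"
  have "?A = la x (braided_antipode a)" by (simp add: eval)
  moreover have "?B = braided_antipode (la x a)" by (simp add: eval)
  moreover have "?A = ?B" by (simp add: la_bullet pull)
  ultimately show ?thesis by simp
qed

text \<open>\<open>rho_la\<close> for \<pi>(a1) acting on the antipode of a2 again produces
  S(S(\<pi>(a4))) S(\<pi>(a3)), which cancels as in \<open>rho_bullet\<close>.\<close>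

lemma rho_braided_antipode:
  assumes [simp]: "a \<in> carrier K"
  shows "\<rho> (braided_antipode a) = coact_sw HK a (\<lambda>x m. tens H K x (braided_antipode m))"
proof -
  let ?S = "antipode H" let ?m = "mult H" let ?SK = "antipode K"
  let ?A = "sw K HK a (\<lambda>a1 a2. sw H HK (\<pi> a1) (\<lambda>x1 r. sw H HK r (\<lambda>x2 x3. coact_sw HK (?SK a2)
    (\<lambda>y n. tens H K (?m (?m x1 y) (?S x3)) (la x2 n)))))"
  let ?B = "sw K HK a (\<lambda>a1 r. sw K HK r (\<lambda>a2 r. sw K HK r (\<lambda>v r. sw K HK r (\<lambda>a5 a6.
     tens H K (?m (\<pi> a1) (?m (?S (\<pi> a6)) (?S (sw K H v (\<lambda>v1 v2. ?m (\<pi> v1) (?S (\<pi> v2)))))))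
       (la (\<pi> a2) (?SK a5))))))"
  have "\<rho> (braided_antipode a) = sw K HK a (\<lambda>a1 a2. \<rho> (la (\<pi> a1) (?SK a2)))"
    by (simp add: braided_antipode_def)
  also have "\<dots> = ?A" by (simp add: rho_la)
  also have "\<dots> = ?B" by (simp add: pull)
  also have "\<dots> = coact_sw HK a (\<lambda>x m. tens H K x (braided_antipode m))"
    by (simp add: eval) (simp add: braided_antipode_def pull)
  finally show ?thesis .
qed

text \<open>Unfolding \<open>bullet\<close> in the left leg puts S(\<pi>(a2)) in front of \<pi>(a3)
  S(\<pi>(a5)) \<rightharpoonup> b1, and the first two factors cancel. What remains is the coproduct
  in \<open>K\<close> of a1 (S(\<pi>(a2)) \<rightharpoonup> b).\<close>

lemma comult_bullet:
  assumes [simp]: "a \<in> carrier K" "b \<in> carrier K"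
  shows "comult K (bullet a b) = sw K KK a (\<lambda>a1 a2. sw K KK b (\<lambda>b1 b2. coact_sw KK a2 (\<lambda>x m.
    tens K K (bullet a1 (la x b1)) (bullet m b2))))"
proof -
  let ?S = "antipode H" let ?m = "mult H"
  let ?T = "sw K KK a (\<lambda>a1 r. sw K KK r (\<lambda>v r. sw K KK r (\<lambda>a2 w. sw K KK b (\<lambda>b1 b2.
    tens K K (mult K a1 (la (sw K H v (\<lambda>v1 v2. ?m (?S (\<pi> v1)) (\<pi> v2))) (la (?S (\<pi> w)) b1))) (bullet a2 b2)))))"
  \<comment> \<open>This instance of the definition unfolds only the left leg and leaves
    \<open>bullet m b2\<close> folded.\<close>
  have bullet_la: "bullet a (la x b) = sw K K a (\<lambda>a1 a2. mult K a1 (la (antipode H (\<pi> a2)) (la x b)))" for a x b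
    by (simp add: bullet_def)
  have "sw K KK a (\<lambda>a1 a2. sw K KK b (\<lambda>b1 b2. coact_sw KK a2 (\<lambda>x m.
    tens K K (bullet a1 (la x b1)) (bullet m b2)))) = ?T"
    by (simp add: bullet_la pull)
  also have "?T = sw K KK a (\<lambda>a1 r. sw K KK r (\<lambda>a2 w. sw K KK b (\<lambda>b1 b2.
    tens K K (mult K a1 (la (?S (\<pi> w)) b1)) (bullet a2 b2))))"
    by (simp add: eval)
  also have "\<dots> = comult K (bullet a b)"
    by (simp add: K.comult_sw) (simp add: bullet_def pull)
  finally show ?thesis by simp
qed

text \<open>By \<open>mult_bullet\<close> the argument of \<pi> is the product of \<open>K\<close>.
  The rule \<open>pi_simps(4)\<close> is removed because it would move \<pi> inside the sum.\<close>

lemma rota_baxter: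
  assumes [simp]: "a \<in> carrier K" "b \<in> carrier K"
  shows "mult H (\<pi> a) (\<pi> b) = \<pi> (sw K K a (\<lambda>a1 a2. bullet a1 (la (\<pi> a2) b)))"
  by (simp add: mult_bullet del: pi_simps(4))

end


section \<open>The double cross product\<close>

text \<open>One vector space occurs under several record types: as a plain space, a Hopf algebra and
  a Yetter-Drinfeld module. This and the next lemmas transport the constructions, which see only
  \<open>carrier\<close> and \<open>scale\<close>.\<close>

lemma tens_same: "scale V = scale V' \<Longrightarrow> scale W = scale W' \<Longrightarrow> tens V W = tens V' W'"
  by (intro ext) (simp add: tens_def bilinear_form_def)

lemma tensor_space_same:
  "carrier V = carrier V' \<Longrightarrow> scale V = scale V' \<Longrightarrow> carrier W = carrier W' \<Longrightarrow> scale W = scale W' \<Longrightarrow>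
   tensor_space V W = tensor_space V' W'"
  by (simp add: tensor_space_def tens_same[of V V' W W'])

lemma tlift_same:
  "carrier V = carrier V' \<Longrightarrow> scale V = scale V' \<Longrightarrow> carrier W = carrier W' \<Longrightarrow> scale W = scale W' \<Longrightarrow>
   tlift V W = tlift V' W'"
  by (simp add: tlift_def decomposition_def fun_eq_iff tens_same[of V V' W W'])

lemma lin_same:
  "carrier V = carrier V' \<Longrightarrow> scale V = scale V' \<Longrightarrow> carrier W = carrier W' \<Longrightarrow> scale W = scale W' \<Longrightarrow>
   lin V W = lin V' W'"
  by (simp add: lin_def fun_eq_iff)

lemma bilin_same:
  "carrier V = carrier V' \<Longrightarrow> scale V = scale V' \<Longrightarrow> carrier W = carrier W' \<Longrightarrow> scale W = scale W' \<Longrightarrow>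
   carrier U = carrier U' \<Longrightarrow> scale U = scale U' \<Longrightarrow> bilin V W U = bilin V' W' U'"
  by (simp add: bilin_def lin_def fun_eq_iff)

lemma is_vspace_same:
  "carrier V = carrier V' \<Longrightarrow> scale V = scale V' \<Longrightarrow> is_vspace V = is_vspace V'"
  by (simp add: is_vspace_def)

section \<open>The double cross product on pure tensors, and the passage from \<theta> to
  \<pi>\<close>

context hopf_matched_pair begin

abbreviation "KH \<equiv> tensor_space K H"
abbreviation "DCP \<equiv> double_cross_product H K la ra"

lemma dcp_mult_tens:
  assumes [simp]: "a \<in> carrier K" "x \<in> carrier H" "b \<in> carrier K" "y \<in> carrier H"
  shows "dcp_mult H K la ra (tens K H a x) (tens K H b y) =
    sw K KH b (\<lambda>b1 b2. sw H KH x (\<lambda>x1 x2. tens K H (mult K a (la x1 b1)) (mult H (ra x2 b2) y)))"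
proof -
  \<comment> \<open>\<open>?E\<close> is the summand of the definition and \<open>?G\<close> its
    version with \<open>sw\<close>. Their agreement on the carriers lets \<open>tlift_cong\<close>
    exchange them.\<close>
  let ?E = "\<lambda>a x b y. sweedler H x (\<lambda>x1 x2. sweedler K b (\<lambda>b1 b2.
         tens K H (mult K a (la x1 b1)) (mult H (ra x2 b2) y)))"
  let ?G = "\<lambda>a x b y. sw K KH b (\<lambda>b1 b2. sw H KH x (\<lambda>x1 x2.
         tens K H (mult K a (la x1 b1)) (mult H (ra x2 b2) y)))"
  have EG: "?E a x b y = ?G a x b y"
    if "a \<in> carrier K" "x \<in> carrier H" "b \<in> carrier K" "y \<in> carrier H" for a x b y
    using that by (simp add: H.sw_eq[where U=KH] K.sw_eq[where U=KH] K_first)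
  have t: "tens K H b y \<in> carrier KH" "tens K H a x \<in> carrier KH" by simp_all
  have B1: "bilin K H KH (?G a x)" if "a \<in> carrier K" "x \<in> carrier H" for a x
    by (rule bilinI) (simp_all add: that)
  have B2: "bilin K H KH (\<lambda>a x. ?G a x b y)"
    by (rule bilinI) simp_all
  have "tlift K H (?E a x) (tens K H b y) = ?G a x b y"
    if "a \<in> carrier K" "x \<in> carrier H" for a x
    using tlift_cong[OF K.vs H.vs t(1) EG[OF that]] tlift_tens[OF K.vs H.vs is_vspace_ts B1[OF that] assms(3,4)]
    by simp
  then have "dcp_mult H K la ra (tens K H a x) (tens K H b y) = tlift K H (\<lambda>a x. ?G a x b y) (tens K H a x)"
    unfolding dcp_mult_def by (intro tlift_cong[OF K.vs H.vs t(2)])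
  also have "\<dots> = ?G a x b y"
    by (rule tlift_tens[OF K.vs H.vs is_vspace_ts B2 assms(1,2)])
  finally show ?thesis .
qed

lemma dcp_carrier [simp]: "carrier DCP = carrier KH" "scale DCP = scale KH"
  by (simp_all add: double_cross_product_def)

lemma dcp_comult_K:
  assumes [simp]: "a \<in> carrier K"
  shows "comult DCP (tens K H a (one H)) = sw K (tensor_space KH KH) a (\<lambda>a1 a2.
    tens KH KH (tens K H a1 (one H)) (tens K H a2 (one H)))"
proof -
  let ?T = "tensor_space KH KH"
  let ?E = "\<lambda>a x. sweedler K a (\<lambda>a1 a2. sweedler H x (\<lambda>x1 x2.
        tens KH KH (tens K H a1 x1) (tens K H a2 x2)))"
  let ?G = "\<lambda>a x. sw K ?T a (\<lambda>a1 a2. sw H ?T x (\<lambda>x1 x2.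
        tens KH KH (tens K H a1 x1) (tens K H a2 x2)))"
  have EG: "?E a x = ?G a x" if "a \<in> carrier K" "x \<in> carrier H" for a x
    using that by (simp add: H.sw_eq[where U="?T"] K.sw_eq[where U="?T"])
  have B: "bilin K H ?T ?G"
    by (rule bilinI) simp_all
  have "comult DCP (tens K H a (one H)) = tlift K H ?G (tens K H a (one H))"
    by (simp add: double_cross_product_def) (intro tlift_cong EG; simp)
  also have "\<dots> = ?G a (one H)"
    by (rule tlift_tens[OF K.vs H.vs is_vspace_ts B]) simp_all
  finally show ?thesis by simp
qed

lemma dcp_counit_K:
  assumes [simp]: "a \<in> carrier K"
  shows "counit DCP (tens K H a (one H)) = counit K a"
proof -
  have B: "bilin K H ground (\<lambda>a x. counit K a * counit H x)"
    by (rule bilinI) (simp_all add: ground_scale lin_ground_mult)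
  show ?thesis
    by (simp add: double_cross_product_def tlift_tens[OF K.vs H.vs is_vspace_gr B])
qed

lemma matched_projection_of_hom:
  assumes hom: "hopf_hom DCP H \<theta>" and sec: "\<forall>x\<in>carrier H. \<theta> (incl_H H K x) = x"
  shows "matched_projection H K la ra (\<theta> \<circ> incl_K H K)"
proof -
  have "lin DCP H \<theta>" using hom by (simp add: hopf_hom_def coalgebra_hom_def)
  then have "lin KH H \<theta>" using lin_same[of DCP KH H H] by simp
  note \<theta> = lin_app[OF is_vspace_ts this]
  note [simp] = \<theta>
  have th_mult: "\<theta> (dcp_mult H K la ra s t) = mult H (\<theta> s) (\<theta> t)"
    if "s \<in> carrier KH" "t \<in> carrier KH" for s t
    using hom that by (simp add: hopf_hom_def double_cross_product_def)
  have th_H [simp]: "\<theta> (tens K H (one K) x) = x" if "x \<in> carrier H" for x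
    using sec that by (simp add: incl_H_def)
  define \<pi> where "\<pi> a = \<theta> (tens K H a (one H))" for a
  have pi: "\<theta> \<circ> incl_K H K = \<pi>" by (simp add: fun_eq_iff incl_K_def \<pi>_def)
  have pi_lin: "lin K H \<pi>" unfolding \<pi>_def[abs_def] by simp
  note [simp] = lin_app[OF K.vs pi_lin]
  have pi_one [simp]: "\<pi> (one K) = one H" by (simp add: \<pi>_def)
  \<comment> \<open>a \<otimes> x is the product of a \<otimes> 1 and 1 \<otimes> x, so \<theta> is
    determined by \<pi>.\<close>
  have th: "\<theta> (tens K H a x) = mult H (\<pi> a) x" if [simp]: "a \<in> carrier K" "x \<in> carrier H" for a x
    using th_mult[of "tens K H a (one H)" "tens K H (one K) x"]
    by (simp add: dcp_mult_tens \<pi>_def)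
  have pi_coalg: "coalgebra_hom K H \<pi>"
    unfolding coalgebra_hom_def
  proof (intro conjI ballI pi_lin)
    fix a assume [simp]: "a \<in> carrier K"
    let ?HH = "tensor_space H H"
    have B: "bilin KH KH ?HH (\<lambda>s t. tens H H (\<theta> s) (\<theta> t))"
      by (rule bilinI) simp_all
    have "comult H (\<pi> a) = sweedler DCP (tens K H a (one H)) (\<lambda>s t. tens H H (\<theta> s) (\<theta> t))"
      using hom by (simp add: hopf_hom_def coalgebra_hom_def \<pi>_def)
    also have "\<dots> = tlift KH KH (\<lambda>s t. tens H H (\<theta> s) (\<theta> t)) (comult DCP (tens K H a (one H)))"
      by (simp add: sweedler_def tlift_same[of DCP KH DCP KH])
    also have "\<dots> = sw K ?HH a (\<lambda>a1 a2. tens H H (\<pi> a1) (\<pi> a2))"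
      by (simp add: dcp_comult_K tlift_sw[OF _ _ _ B] tlift_tens[OF _ _ _ B] \<pi>_def)
    finally show "comult H (\<pi> a) = sweedler K a (\<lambda>a1 a2. tens H H (\<pi> a1) (\<pi> a2))"
      by (simp add: K.sw_eq[where U="?HH"])
    show "counit H (\<pi> a) = counit K a"
      using hom dcp_counit_K[of a] by (simp add: hopf_hom_def coalgebra_hom_def \<pi>_def)
  qed
  show ?thesis unfolding pi
  proof (unfold_locales)
    show "coalgebra_hom K H \<pi>" by (rule pi_coalg)
    show "\<pi> (one K) = one H" by (rule pi_one)
  next
    fix a b assume [simp]: "a \<in> carrier K" "b \<in> carrier K"
    show "\<pi> (mult K a b) = mult H (\<pi> a) (\<pi> b)"
      using th_mult[of "tens K H a (one H)" "tens K H b (one H)"]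
      by (simp add: dcp_mult_tens \<pi>_def)
  next
    fix x b assume [simp]: "x \<in> carrier H" "b \<in> carrier K"
    \<comment> \<open>This is \<theta> of the product of 1 \<otimes> x and b \<otimes> 1, with
      \<open>th\<close> applied to each summand.\<close>
    show "mult H x (\<pi> b) = sw K H b (\<lambda>b1 b2. sw H H x (\<lambda>x1 x2. mult H (\<pi> (la x1 b1)) (ra x2 b2)))"
      using th_mult[of "tens K H (one K) x" "tens K H b (one H)"]
      by (simp add: dcp_mult_tens th)
  qed
qed

end


section \<open>The braided Hopf algebra\<close>

context matched_projection begin

abbreviation "L \<equiv> deformed K la \<pi>"

lemma L_simps [simp]:
  "carrier L = carrier K" "scale L = scale K" "one L = one K" "comult L = comult K" "counit L = counit K"
  by (simp_all add: deformed_def)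

lemma L_same:
  "tens L L = tens K K" "tensor_space L L = KK" "tlift L L = tlift K K"
  "tens H L = tens H K" "tlift H L = tlift H K" "tensor_space H L = HK" "tens L KK = tens K KK"
  "tensor_space L KK = tensor_space K KK" "is_vspace L"
  by (rule tens_same tlift_same tensor_space_same; simp)+ (simp add: is_vspace_same[of L K])

lemma L_lin: "lin L X = lin K X" "lin Y L = lin Y K" "bilin L L L = bilin K K K"
  "lin L L = lin K K"
  by (rule lin_same bilin_same; simp)+

lemma L_sweedler: "sweedler L = sweedler K" "sweedler3 L = sweedler3 K"
  by (simp_all add: fun_eq_iff sweedler_def sweedler3_def L_same)

lemma L_mult [simp]: "a \<in> carrier K \<Longrightarrow> b \<in> carrier K \<Longrightarrow> mult L a b = bullet a b"
  by (simp add: deformed_def bullet_def K.sw_eq[where U=K])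

lemma L_antipode [simp]: "a \<in> carrier K \<Longrightarrow> antipode L a = braided_antipode a"
  by (simp add: deformed_def braided_antipode_def K.sw_eq[where U=K])

lemma L_mult_bilin: "bilin K K K (mult L)"
  by (subst bilin_cong[OF K.vs K.vs, of _ bullet]) (simp_all add: bullet_bilin)

lemma tlift_L_mult: "t \<in> carrier KK \<Longrightarrow> tlift K K (mult L) t = tlift K K bullet t"
  by (rule tlift_cong[OF K.vs K.vs]) simp_all

lemma L_algebra: "algebra L"
  using L_mult_bilin by (simp add: algebra_def L_same L_lin)

lemma L_coalgebra: "coalgebra L"
  using K.coalg unfolding coalgebra_def by (simp add: L_same L_lin L_sweedler)

lemma L_conv: "convolution_inverse_id L"
  using braided_antipode_lin
  by (simp add: convolution_inverse_id_def L_lin L_sweedler K.sw_eq[where U=K] eval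
      lin_cong[OF K.vs, of "antipode L" braided_antipode])

lemma L_counit: "counit_algebra_map L"
proof -
  have "counit K (bullet a b) = counit K a * counit K b" if [simp]: "a \<in> carrier K" "b \<in> carrier K" for a b
  proof -
    \<comment> \<open>The factor \<epsilon>(a2) left over by the antipode is displayed as a scalar,
      which the counit law absorbs.\<close>
    have "counit K (bullet a b) =
        sw K ground a (\<lambda>a1 a2. scale ground (counit K a2) (counit K a1 * counit K b))"
      by (simp add: bullet_def ground_scale mult.left_commute)
    then show ?thesis by (simp add: lin_ground_mult)
  qed
  then show ?thesis by (simp add: counit_algebra_map_def)
qed

text \<open>The diagonal action on K \<otimes> K in the form used by the calculus. In
  \<open>L_yd_hopf\<close> it is identified with the action of \<open>yd_tensor\<close>, and
  \<open>\<rho>_square\<close> with the coaction.\<close>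

definition act_square where
  "act_square x = tlift K K (\<lambda>m n. sw H KK x (\<lambda>x1 x2. tens K K (la x1 m) (la x2 n)))"

lemma act_square_bilin: "x \<in> carrier H \<Longrightarrow> bilin K K KK (\<lambda>m n. sw H KK x (\<lambda>x1 x2. tens K K (la x1 m) (la x2 n)))"
  by (rule bilinI) simp_all

lemma act_square_lin: "x \<in> carrier H \<Longrightarrow> lin KK KK (act_square x)"
  unfolding act_square_def by (rule lin_tlift[OF K.vs K.vs is_vspace_ts act_square_bilin])

lemma act_square_tens: "x \<in> carrier H \<Longrightarrow> m \<in> carrier K \<Longrightarrow> n \<in> carrier K \<Longrightarrow>
    act_square x (tens K K m n) = sw H KK x (\<lambda>x1 x2. tens K K (la x1 m) (la x2 n))"
  unfolding act_square_def by (rule tlift_tens[OF K.vs K.vs is_vspace_ts act_square_bilin])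

abbreviation "HKK \<equiv> tensor_space H KK"

definition \<rho>_square where
  "\<rho>_square = tlift K K (\<lambda>m n. coact_sw HKK m (\<lambda>x m0. coact_sw HKK n (\<lambda>y n0. tens H KK (mult H x y) (tens K K m0 n0))))"

lemma rho_square_bilin: "bilin K K HKK
    (\<lambda>m n. coact_sw HKK m (\<lambda>x m0. coact_sw HKK n (\<lambda>y n0. tens H KK (mult H x y) (tens K K m0 n0))))"
  by (rule bilinI) simp_all

lemma rho_square_lin: "lin KK HKK \<rho>_square"
  unfolding \<rho>_square_def by (rule lin_tlift[OF K.vs K.vs is_vspace_ts rho_square_bilin])

lemma rho_square_tens: "m \<in> carrier K \<Longrightarrow> n \<in> carrier K \<Longrightarrow>
    \<rho>_square (tens K K m n) = coact_sw HKK m (\<lambda>x m0. coact_sw HKK n (\<lambda>y n0. tens H KK (mult H x y) (tens K K m0 n0)))"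
  unfolding \<rho>_square_def by (rule tlift_tens[OF K.vs K.vs is_vspace_ts rho_square_bilin])

text \<open>Replaces a summand from the definitions, phrased with \<open>sweedler\<close> or
  \<open>mult L\<close>, by the expression in \<open>sw\<close> or \<open>bullet\<close> that equals
  it on the carriers.\<close>

lemma tlift_rho_cong:
  assumes U: "is_vspace U" and a: "a \<in> carrier K"
    and eq: "\<And>x m. x \<in> carrier H \<Longrightarrow> m \<in> carrier K \<Longrightarrow> F x m = G x m"
    and G: "\<And>y. y \<in> carrier K \<Longrightarrow> lin H U (\<lambda>x. G x y)" "\<And>x. x \<in> carrier H \<Longrightarrow> lin K U (\<lambda>y. G x y)"
  shows "tlift H K F (\<rho> a) = coact_sw U a G"
proof -
  have "tlift H K F (\<rho> a) = tlift H K G (\<rho> a)"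
    by (rule tlift_cong[OF H.vs K.vs _ eq]) (simp_all add: a)
  then show ?thesis using tlift_rho[OF U a G] by simp
qed

lemma rho_one: "\<rho> (one K) = tens H K (one H) (one K)"
  by (simp add: \<rho>_def)

lemma ground_one: "c \<in> carrier ground" "scale ground c 1 = c"
  by (simp_all add: ground_def)

lemma rho_counit_hom:
  assumes [simp]: "a \<in> carrier K"
  shows "coact_sw (tensor_space H ground) a (\<lambda>x m. tens H ground x (counit K m)) =
    tens H ground (one H) (counit K a)"
proof -
  let ?T = "tensor_space H ground"
  note [simp] = ground_one(1)
  \<comment> \<open>Moving the scalar in front turns the counit of \<open>m\<close> into a
    coefficient that the counit law can absorb.\<close>
  have t: "tens H ground x c = scale ?T c (tens H ground x 1)" if "x \<in> carrier H" for x c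
    using tens_app(2)[OF H.vs is_vspace_gr that ground_one(1), of c 1] by (simp add: ground_one)
  have "coact_sw ?T a (\<lambda>x m. tens H ground x (counit K m)) =
      coact_sw ?T a (\<lambda>x m. scale ?T (counit K m) (tens H ground x 1))"
    by (simp add: t[of _ "counit K _"])
  also have "\<dots> = sw K ?T a (\<lambda>a1 a2. tens H ground (mult H (\<pi> a1) (antipode H (\<pi> a2))) 1)"
    by simp
  also have "\<dots> = tens H ground (sw K H a (\<lambda>a1 a2. mult H (\<pi> a1) (antipode H (\<pi> a2)))) 1"
    by simp
  also have "\<dots> = tens H ground (one H) (counit K a)"
    by (simp add: eval t[of _ "counit K _"])
  finally show ?thesis .
qed

text \<open>Stated for any \<open>c\<close> that agrees with \<rho> on the carrier, so that it
  covers both \<open>Coad\<close> and the coaction written out in the theorem.\<close>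

lemma L_yd_hopf:
  assumes c: "\<And>a. a \<in> carrier K \<Longrightarrow> c a = \<rho> a"
  shows "yd_hopf_algebra H la c L"
proof -
  \<comment> \<open>\<open>M\<close>, \<open>N\<close> and \<open>I\<close> are K_\<pi>, its tensor
    square and the unit object; the transport lemmas identify their spaces with \<open>K\<close>,
    \<open>KK\<close> and \<open>ground\<close>.\<close>
  define M where "M = yd_object L la c"
  have M [simp]: "carrier M = carrier K" "scale M = scale K" "action M = la" "coaction M = c"
    by (simp_all add: M_def yd_object_def)
  have M_same: "tens M M = tens K K" "tensor_space M M = KK" "tlift M M = tlift K K"
    "tens H M = tens H K" "tlift H M = tlift H K" "tensor_space H M = HK"
    by (rule tens_same tlift_same tensor_space_same; simp)+
  define N where "N = yd_tensor H M M"
  have N [simp]: "carrier N = carrier KK" "scale N = scale KK"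
    by (simp_all add: N_def yd_tensor_def M_same)
  have N_same: "tens H N = tens H KK" "tlift H N = tlift H KK" "tensor_space H N = HKK"
    by (rule tens_same tlift_same tensor_space_same; simp)+
  define I where "I = yd_unit H"
  have I [simp]: "carrier I = carrier ground" "scale I = scale ground"
    "action I = (\<lambda>x c. counit H x * c)" "coaction I = (\<lambda>c. tens H ground (one H) c)"
    by (simp_all add: I_def yd_unit_def)
  have I_same: "tens H I = tens H ground" "tlift H I = tlift H ground"
      "tensor_space H I = tensor_space H ground"
    by (rule tens_same tlift_same tensor_space_same; simp)+
  have lins: "lin M X = lin K X" "lin Y M = lin Y K" "lin N X = lin KK X" "lin Y N = lin Y KK"
    "lin I X = lin ground X" "lin Y I = lin Y ground" "bilin H M M = bilin H K K"
    "lin M M = lin K K" "lin M N = lin K KK" "lin N M = lin KK K" "lin I M = lin ground K" "lin M I = lin K ground" for X Y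
    by (rule lin_same bilin_same; simp)+
  have vM: "is_vspace M" using is_vspace_same[of M K] by simp
  have actN: "action N x t = act_square x t" if "x \<in> carrier H" "t \<in> carrier KK" for x t
    unfolding act_square_def N_def yd_tensor_def
    by (simp add: M_same) (rule tlift_cong[OF K.vs K.vs that(2)]; simp add: that H.sw_eq[where U=KK])
  have coactN: "coaction N t = \<rho>_square t" if "t \<in> carrier KK" for t
  proof -
    have "tlift H K (\<lambda>x m0. tlift H K (\<lambda>y n0. tens H KK (mult H x y) (tens K K m0 n0)) (\<rho> n)) (\<rho> m) =
      coact_sw HKK m (\<lambda>x m0. coact_sw HKK n (\<lambda>y n0. tens H KK (mult H x y) (tens K K m0 n0)))"
      if mn [simp]: "m \<in> carrier K" "n \<in> carrier K" for m n
      by (rule tlift_rho_cong[where G="\<lambda>x m0. coact_sw HKK n (\<lambda>y n0. tens H KK (mult H x y) (tens K K m0 n0))"])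
        (simp_all add: tlift_rho[where U=HKK])
    then show ?thesis
      unfolding \<rho>_square_def N_def yd_tensor_def using that
      by (simp add: M_same) (rule tlift_cong[OF K.vs K.vs that]; simp add: c)
  qed
  have "lin K HK c" by (simp add: lin_cong[OF K.vs c] rho_lin)
  have "yd_module H M"
    unfolding yd_module_def left_module_def
  proof (simp add: vM lins M_same la_bilin H.hopf, intro conjI ballI)
    show "lin K HK c" by fact
  next
    fix a assume [simp]: "a \<in> carrier K"
    let ?T = "tensor_space H HK"
    show "tlift H K (\<lambda>x m0. sweedler H x (\<lambda>x1 x2. tens H HK x1 (tens H K x2 m0))) (c a) =
      tlift H K (\<lambda>x m0. tens H HK x (c m0)) (c a)"
      unfolding c[OF \<open>a \<in> carrier K\<close>]
      apply (subst tlift_rho_cong[where U="?T" and G="\<lambda>x m0. sw H ?T x (\<lambda>x1 x2. tens H HK x1 (tens H K x2 m0))"])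
           apply (simp_all add: H.sw_eq[where U="?T"])[5]
      apply (subst tlift_rho_cong[where U="?T" and G="\<lambda>x m0. tens H HK x (\<rho> m0)"])
           apply (simp_all add: c)[5]
      by (rule rho_coassoc) simp
    show "tlift H K (\<lambda>x m0. scale K (counit H x) m0) (c a) = a"
      by (simp add: c tlift_rho[where U=K])
  next
    fix x a assume [simp]: "x \<in> carrier H" "a \<in> carrier K"
    show "c (la x a) = sweedler3 H x (\<lambda>x1 x2 x3. tlift H K (\<lambda>y m0.
          tens H K (mult H (mult H x1 y) (antipode H x3)) (la x2 m0)) (c a))"
      by (simp add: c rho_la sweedler3_def H.sw_eq[where U=HK] tlift_rho[where U=HK])
  qed
  moreover have "yd_hom H N M (tlift K K (mult L))"
    unfolding yd_hom_def
  proof (simp add: lins N_same M_same, intro conjI ballI)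
    let ?f = "tlift K K bullet"
    have f_lin: "lin KK K ?f" by (rule lin_tlift[OF K.vs K.vs K.vs bullet_bilin])
    have f_tens: "?f (tens K K a b) = bullet a b" if "a \<in> carrier K" "b \<in> carrier K" for a b
      by (rule tlift_tens[OF K.vs K.vs K.vs bullet_bilin that])
    note f = lin_app[OF is_vspace_ts f_lin]
    note r2 = lin_app[OF is_vspace_ts rho_square_lin]
    show "lin KK K (tlift K K (mult L))"
      by (rule lin_tlift[OF K.vs K.vs K.vs L_mult_bilin])
    {
      fix x t assume x [simp]: "x \<in> carrier H" and t [simp]: "t \<in> carrier KK"
      note a2 = lin_app[OF is_vspace_ts act_square_lin[OF x]]
      have "?f (act_square x t) = la x (?f t)"
      \<comment> \<open>Both sides are linear in \<open>t\<close>; on pure tensors the claim is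
        \<open>la_bullet\<close>.\<close>
      proof (rule tensor_ext[OF K.vs K.vs _ _ _ t])
        show "lin KK K (\<lambda>t. ?f (act_square x t))" by (rule f(2)[OF act_square_lin[OF x]])
        show "lin KK K (\<lambda>t. la x (?f t))" by (simp add: f_lin)
        fix a b assume [simp]: "a \<in> carrier K" "b \<in> carrier K"
        show "?f (act_square x (tens K K a b)) = la x (?f (tens K K a b))"
          by (simp add: act_square_tens f f_tens la_bullet)
      qed
      then show "tlift K K (mult L) (action N x t) = la x (tlift K K (mult L) t)"
        by (simp add: actN tlift_L_mult a2)
    }
    fix t assume t [simp]: "t \<in> carrier KK"
    have B: "bilin H KK HK (\<lambda>x m0. tens H K x (?f m0))"
      by (rule bilinI) (simp_all add: f f_lin)
    have "\<rho> (?f t) = tlift H KK (\<lambda>x m0. tens H K x (?f m0)) (\<rho>_square t)"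
    \<comment> \<open>Again it suffices to check pure tensors, where the claim is
      \<open>rho_bullet\<close>.\<close>
    proof (rule tensor_ext[OF K.vs K.vs _ _ _ t])
      show "lin KK HK (\<lambda>t. \<rho> (?f t))" by (simp add: f_lin)
      show "lin KK HK (\<lambda>t. tlift H KK (\<lambda>x m0. tens H K x (?f m0)) (\<rho>_square t))"
        by (rule lin_tlift_arg[OF H.vs is_vspace_ts is_vspace_ts B rho_square_lin])
      fix a b assume [simp]: "a \<in> carrier K" "b \<in> carrier K"
      show "\<rho> (?f (tens K K a b)) = tlift H KK (\<lambda>x m0. tens H K x (?f m0)) (\<rho>_square (tens K K a b))"
        by (simp add: f_tens rho_bullet rho_square_tens tlift_sw[OF H.vs is_vspace_ts is_vspace_ts B]
            tlift_tens[OF H.vs is_vspace_ts is_vspace_ts B])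
    qed
    also have "\<dots> = tlift H KK (\<lambda>x m0. tens H K x (tlift K K (mult L) m0)) (\<rho>_square t)"
      by (rule tlift_cong[OF H.vs is_vspace_ts]) (simp_all add: r2 tlift_L_mult)
    finally show "c (tlift K K (mult L) t) =
        tlift H KK (\<lambda>x m0. tens H K x (tlift K K (mult L) m0)) (coaction N t)"
      by (simp add: coactN tlift_L_mult c f)
  qed
  moreover have "yd_hom H I M (\<lambda>c. scale K c (one K))"
    unfolding yd_hom_def
  proof (simp add: lins I_same M_same, intro conjI ballI)
    show "scale K (counit H x) (scale K z (one K)) = scale K z (scale K (counit H x) (one K))" for x z
      by (simp flip: scale_mult add: mult.commute)
    fix z :: 'k
    have B: "bilin H ground HK (\<lambda>x m0. tens H K x (scale K m0 (one K)))"
      by (rule bilinI) simp_all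
    show "c (scale K z (one K)) = tlift H ground (\<lambda>x m0. tens H K x (scale K m0 (one K))) (tens H ground (one H) z)"
      using tlift_tens[OF H.vs is_vspace_gr is_vspace_ts B H.one_closed ground_one(1)[of z]]
      by (simp add: c rho_one)
  qed
  moreover have "yd_hom H M N (comult K)"
    unfolding yd_hom_def
  proof (simp add: lins N_same M_same, intro conjI ballI)
    show lin_c: "lin K KK (comult K)" using K.coalg by (simp add: coalgebra_def)
    {
      fix x a assume [simp]: "x \<in> carrier H" "a \<in> carrier K"
      note a2 = lin_app[OF is_vspace_ts act_square_lin[OF \<open>x \<in> carrier H\<close>]]
      show "comult K (la x a) = action N x (comult K a)"
        by (simp add: actN K.comult_sw a2 act_square_tens pull)
    }
    fix a assume [simp]: "a \<in> carrier K"
    note r2 = lin_app[OF is_vspace_ts rho_square_lin]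
    have "coaction N (comult K a) = coact_sw HKK a (\<lambda>x m. tens H KK x (comult K m))"
      using rho_comult[of a] by (simp add: coactN K.comult_sw[of a] r2 rho_square_tens)
    also have "\<dots> = tlift H K (\<lambda>x m0. tens H KK x (comult K m0)) (\<rho> a)"
      by (rule tlift_rho[symmetric]) (simp_all add: lin_c linD(1)[OF lin_c])
    finally show "coaction N (comult K a) = tlift H K (\<lambda>x m0. tens H KK x (comult K m0)) (c a)"
      by (simp add: c)
  qed
  moreover have "yd_hom H M I (counit K)"
    unfolding yd_hom_def
    by (simp add: lins I_same M_same K.eps_lin c tlift_rho[where U="tensor_space H ground"] rho_counit_hom ground_one)
  moreover have "yd_hom H M M (antipode L)"
    unfolding yd_hom_def
  proof (simp add: lins M_same c, intro conjI ballI)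
    show "lin K K (antipode L)" by (simp add: lin_cong[OF K.vs L_antipode] braided_antipode_lin)
    fix a assume [simp]: "a \<in> carrier K"
    show "braided_antipode (la x a) = la x (braided_antipode a)" if "x \<in> carrier H" for x
      using that by (simp add: braided_antipode_la)
    show "\<rho> (braided_antipode a) = tlift H K (\<lambda>x m0. tens H K x (antipode L m0)) (\<rho> a)"
      by (subst tlift_rho_cong[where U=HK and G="\<lambda>x m0. tens H K x (braided_antipode m0)"]) (simp_all add: rho_braided_antipode braided_antipode_lin)
  qed
  moreover have "comult K (one K) = tens K K (one K) (one K)"
    by (simp add: K.comult_sw)
  moreover have "comult K (bullet a b) = sweedler K a (\<lambda>a1 a2. sweedler K b (\<lambda>b1 b2.
      tlift H K (\<lambda>x a20. tens K K (mult L a1 (la x b1)) (mult L a20 b2)) (c a2)))"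
    if [simp]: "a \<in> carrier K" "b \<in> carrier K" for a b
  proof -
    have "tlift H K (\<lambda>x a20. tens K K (mult L a1 (la x b1)) (mult L a20 b2)) (c a2) =
      coact_sw KK a2 (\<lambda>x m. tens K K (bullet a1 (la x b1)) (bullet m b2))"
      if [simp]: "a1 \<in> carrier K" "a2 \<in> carrier K" "b1 \<in> carrier K" "b2 \<in> carrier K" for a1 a2 b1 b2
      unfolding c[OF \<open>a2 \<in> carrier K\<close>] by (rule tlift_rho_cong) simp_all
    then show ?thesis
      by (simp add: comult_bullet K.sw_eq[where U=KK])
  qed
  ultimately show ?thesis
    unfolding yd_hopf_algebra_def Let_def M_def[symmetric] N_def[symmetric] I_def[symmetric]
    by (simp add: L_algebra L_coalgebra L_conv L_counit L_same L_sweedler)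
qed

lemma L_rota_baxter:
  "(\<forall>a\<in>carrier K. Coad H L \<pi> a =
           sweedler3 K a (\<lambda>a1 a2 a3. tens H K (\<pi> (mult K a1 (antipode K a3))) a2))"
  "yd_hopf_algebra H la (\<lambda>a. sweedler3 K a (\<lambda>a1 a2 a3. tens H K (\<pi> (mult K a1 (antipode K a3))) a2)) L"
  "relative_rota_baxter H L la \<pi>"
proof -
  \<comment> \<open>The two coactions meet in \<pi>(a1 S(a3)) = \<pi>(a1) S(\<pi>(a3)), by
    multiplicativity of \<pi> and \<open>pi_antipode\<close>.\<close>
  have c1: "sweedler3 K a (\<lambda>a1 a2 a3. tens H K (\<pi> (mult K a1 (antipode K a3))) a2) = \<rho> a"
    if "a \<in> carrier K" for a
    using that by (simp add: sweedler3_def K.sw_eq[where U=HK] \<rho>_def)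
  have c2: "Coad H L \<pi> a = \<rho> a" if "a \<in> carrier K" for a
    using that by (simp add: Coad_def L_sweedler L_same sweedler3_def K.sw_eq[where U=HK] \<rho>_def)
  show "\<forall>a\<in>carrier K. Coad H L \<pi> a =
           sweedler3 K a (\<lambda>a1 a2 a3. tens H K (\<pi> (mult K a1 (antipode K a3))) a2)"
    by (simp add: c1 c2)
  show "yd_hopf_algebra H la (\<lambda>a. sweedler3 K a (\<lambda>a1 a2 a3. tens H K (\<pi> (mult K a1 (antipode K a3))) a2)) L"
    by (rule L_yd_hopf) (rule c1)
  have "coalgebra_hom L H \<pi>"
    using pi_coalg by (simp add: coalgebra_hom_def L_lin L_sweedler)
  then show "relative_rota_baxter H L la \<pi>"
    unfolding relative_rota_baxter_def
    by (simp add: H.hopf L_yd_hopf c2 L_sweedler rota_baxter K.sw_eq[where U=K] del: pi_simps(4))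
qed

end

theorem theorem4p4:
  fixes H :: "('k::field, 'h::ab_group_add) hopf"
    and K :: "('k, 'l::ab_group_add) hopf"
    and la :: "'h \<Rightarrow> 'l \<Rightarrow> 'l" and ra :: "'h \<Rightarrow> 'l \<Rightarrow> 'h"
    and \<theta> :: "('k, 'l, 'h) tensor \<Rightarrow> 'h" and \<pi> :: "'l \<Rightarrow> 'h"
  assumes "matched_pair H K la ra"
    and "hopf_hom (double_cross_product H K la ra) H \<theta>"
    and "\<forall>x\<in>carrier H. \<theta> (incl_H H K x) = x"
    and "\<pi> = \<theta> \<circ> incl_K H K"
  shows "yd_hopf_algebra H la
           (\<lambda>a. sweedler3 K a (\<lambda>a1 a2 a3. tens H K (\<pi> (mult K a1 (antipode K a3))) a2))
           (deformed K la \<pi>) \<and>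
         (\<forall>a\<in>carrier K.
           Coad H (deformed K la \<pi>) \<pi> a =
           sweedler3 K a (\<lambda>a1 a2 a3. tens H K (\<pi> (mult K a1 (antipode K a3))) a2)) \<and>
         relative_rota_baxter H (deformed K la \<pi>) la \<pi>"
proof -
  interpret hopf_matched_pair H K la ra
    using assms(1) by unfold_locales (auto simp: matched_pair_def)
  \<comment> \<open>From here on \<theta> enters only through \<pi>.\<close>
  interpret matched_projection H K la ra \<pi>
    unfolding assms(4) by (rule matched_projection_of_hom[OF assms(2,3)])
  show ?thesis using L_rota_baxter by blast
qed


end
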